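(* Let $a,b$ be the autoregressive and moving average polynomials and $L$ the driving Lévy process of the CARMA state-space model described in the context. Suppose that $\mathbb E L(1)=0$ and $\mathbb E|L(1)|^2=\sigma^2<\infty$ and that all eigenvalues of $\mathbf A$ have strictly negative real parts. Let $\omega>0$ and, for $T>0$, put $$Z(T):=\frac1{\sqrt T}\frac{b(i\omega)}{a(i\omega)}\int_0^Te^{-i\omega t}\,dL(t),$$ identified with the $\mathbb R^2$-valued random vector $[\Re Z(T),\Im Z(T)]^T$. Then, as $T\to\infty$, $[\Re Z(T),\Im Z(T)]^T$ converges in distribution to $\mathcal N(0,\Sigma)$, where $\Sigma=\frac{\sigma^2}2\left|\frac{b(i\omega)}{a(i\omega)}\right|^2I_{2\times2}$.
   Context: Let $p>q\ge 0$ be integers, $a(z)=z^p+a_1z^{p-1}+\dots+a_p$ and $b(z)=b_0+b_1z+\dots+b_{p-1}z^{p-1}$ polynomials with real coefficients, with $b_q\ne 0$ and $b_j=0$ for $q<j<p$. Let $\mathbf A\in\mathbb R^{p\times p}$ be the companion matrix $$\mathbf A=\begin{pmatrix}0&1&0&\cdots&0\\0&0&1&\cdots&0\\ \vdots&\vdots&\vdots&\ddots&\vdots\\0&0&0&\cdots&1\\-a_p&-a_{p-1}&-a_{p-2}&\cdots&-a_1\end{pmatrix}$$ (with $\mathbf A=-a_1$ if $p=1$), $\mathbf e=[0,\dots,0,1]^T\in\mathbb R^p$, $\mathbf b=[b_0,b_1,\dots,b_{p-1}]^T\in\mathbb R^p$. Let $(L(t))_{t\ge 0}$ be a one-dimensional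 (real-valued) Lévy process with $L(0)=0$ a.s., on a filtered probability space satisfying the usual hypotheses. State-space representation: the $\mathbb R^p$-valued process $\mathbf X$ solves $d\mathbf X(t)=\mathbf A\mathbf X(t)\,dt+\mathbf e\,dL(t)$, i.e. $\mathbf X(t)=e^{\mathbf At}\mathbf X(0)+\int_0^te^{\mathbf A(t-u)}\mathbf e\,dL(u)$ for $t\ge 0$, and the CARMA process is $Y(t)=\mathbf b^T\mathbf X(t)$. $I_{2\times 2}$ is the $2\times2$ identity matrix. *)

theory Defs
  imports "HOL-Probability.Probability" "Jordan_Normal_Form.Char_Poly"
begin

text \<open>HOL-Analysis vectors \<open>real ^ 'n\<close> carry the random vectors; the companion matrix, whose
  dimension is a number, is a matrix of Jordan_Normal_Form.\<close>

no_notation Matrix.vec_index (infixl \<open>$\<close> 100)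
no_notation Matrix.transpose_mat (\<open>(_\<^sup>T)\<close> [1000])

subsection \<open>Modes of convergence\<close>

definition tendsto_in_prob ::
  "'a measure \<Rightarrow> ('i \<Rightarrow> 'a \<Rightarrow> 'b::metric_space) \<Rightarrow> ('a \<Rightarrow> 'b) \<Rightarrow> 'i filter \<Rightarrow> bool" where
  "tendsto_in_prob M X Y G \<longleftrightarrow>
     (\<forall>\<epsilon>>0. ((\<lambda>i. measure M {x \<in> space M. dist (X i x) (Y x) > \<epsilon>}) \<longlongrightarrow> 0) G)"

definition tendsto_in_distribution ::
  "'a measure \<Rightarrow> ('i \<Rightarrow> 'a \<Rightarrow> 'b::topological_space) \<Rightarrow> 'b measure \<Rightarrow> 'i filter \<Rightarrow> bool" where
  "tendsto_in_distribution M X N G \<longleftrightarrow>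
     (\<forall>\<^sub>F i in G. X i \<in> borel_measurable M) \<and> sets N = sets borel \<and> prob_space N \<and>
     (\<forall>f::'b \<Rightarrow> real. continuous_on UNIV f \<longrightarrow> bounded (range f) \<longrightarrow>
        ((\<lambda>i. \<integral>x. f (X i x) \<partial>M) \<longlongrightarrow> (\<integral>y. f y \<partial>N)) G)"

subsection \<open>Multivariate normal distributions\<close>

definition std_normal_vector :: "(real ^ 'n) measure" where
  "std_normal_vector =
     density lborel (\<lambda>x. ennreal (\<Prod>i\<in>UNIV. normal_density 0 1 (x $ i)))"

text \<open>The law of \<open>\<mu> + S *v \<xi>\<close> with \<open>\<xi>\<close> standard normal and \<open>S S\<^sup>T = \<Sigma>\<close>. It does not depend on the
  choice of \<open>S\<close>, and it allows singular covariance matrices \<open>\<Sigma>\<close>. (There is no such \<open>S\<close> if \<open>\<Sigma>\<close> is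
  not symmetric positive semidefinite; the value is then meaningless.)\<close>

definition mv_normal :: "real ^ 'n \<Rightarrow> real ^ 'n ^ 'n \<Rightarrow> (real ^ 'n) measure" where
  "mv_normal \<mu> \<Sigma> =
     distr std_normal_vector borel (\<lambda>x. \<mu> + (SOME S :: real ^ 'n ^ 'n. S ** transpose S = \<Sigma>) *v x)"

subsection \<open>Levy processes\<close>

text \<open>Time is \<open>[0,\<infinity>)\<close>. Processes and filtrations are indexed by all reals, but nothing is required
  of a process at negative times. That the filtration is monotone on all of \<open>\<real>\<close> is no restriction:
  put \<open>F t = F 0\<close> for \<open>t < 0\<close>.\<close>

locale usual_filtered_prob_space =
  prob_space M + complete_measure M + filtration "space M" F
  for M :: "'a measure" and F :: "real \<Rightarrow> 'a measure" +
  assumes sets_F_le: "\<And>t. sets (F t) \<subseteq> sets M"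
    and null_sets_F: "null_sets M \<subseteq> sets (F 0)"
    and right_continuous: "\<And>t. 0 \<le> t \<Longrightarrow> sets (F t) = (\<Inter>s\<in>{t<..}. sets (F s))"

locale levy_process =
  usual_filtered_prob_space M F
  for M :: "'a measure" and F :: "real \<Rightarrow> 'a measure" +
  fixes L :: "real \<Rightarrow> 'a \<Rightarrow> real"
  assumes adapted: "\<And>t. 0 \<le> t \<Longrightarrow> L t \<in> borel_measurable (F t)"
    and zero: "AE x in M. L 0 x = 0"
    and indep_increments: "\<And>s t. 0 \<le> s \<Longrightarrow> s \<le> t \<Longrightarrow>
      indep_set (sets (F s)) {(\<lambda>x. L t x - L s x) -` B \<inter> space M | B. B \<in> sets borel}"
    and stationary_increments: "\<And>s t. 0 \<le> s \<Longrightarrow> s \<le> t \<Longrightarrow>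
      distr M borel (\<lambda>x. L t x - L s x) = distr M borel (L (t - s))"
    and stochastically_continuous: "\<And>t. 0 \<le> t \<Longrightarrow> tendsto_in_prob M L (L t) (at t within {0..})"
    and cadlag: "AE x in M. \<forall>t\<ge>0. ((\<lambda>s. L s x) \<longlongrightarrow> L t x) (at_right t) \<and>
      (t > 0 \<longrightarrow> (\<exists>l. ((\<lambda>s. L s x) \<longlongrightarrow> l) (at_left t)))"

subsection \<open>Stochastic integrals of deterministic functions\<close>

text \<open>The step function \<open>\<Sum>i<n. c i * indicator {\<tau> i<..\<tau> (i+1)}\<close> on \<open>(0, T]\<close>, where
  \<open>0 = \<tau> 0 \<le> \<dots> \<le> \<tau> n = T\<close>, and its integral with respect to \<open>L\<close>.\<close>

definition subdivision :: "real \<Rightarrow> nat \<Rightarrow> (nat \<Rightarrow> real) \<Rightarrow> bool" where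
  "subdivision T n \<tau> \<longleftrightarrow> \<tau> 0 = 0 \<and> \<tau> n = T \<and> (\<forall>i<n. \<tau> i \<le> \<tau> (Suc i))"

definition step_fun :: "nat \<Rightarrow> (nat \<Rightarrow> real) \<Rightarrow> (nat \<Rightarrow> complex) \<Rightarrow> real \<Rightarrow> complex" where
  "step_fun n \<tau> c t = (\<Sum>i<n. c i * indicator {\<tau> i<..\<tau> (Suc i)} t)"

definition step_integral ::
  "(real \<Rightarrow> 'a \<Rightarrow> real) \<Rightarrow> nat \<Rightarrow> (nat \<Rightarrow> real) \<Rightarrow> (nat \<Rightarrow> complex) \<Rightarrow> 'a \<Rightarrow> complex" where
  "step_integral L n \<tau> c x = (\<Sum>i<n. c i * complex_of_real (L (\<tau> (Suc i)) x - L (\<tau> i) x))"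

text \<open>The semimartingale integral is the extension of the elementary integral by continuity, from
  uniform convergence of the integrands to convergence in probability. For a deterministic
  integrand \<open>f\<close> that is a uniform limit of step functions on \<open>(0, T]\<close> (in particular for continuous
  \<open>f\<close>), deterministic step functions determine it.\<close>

definition is_levy_integral ::
  "'a measure \<Rightarrow> (real \<Rightarrow> 'a \<Rightarrow> real) \<Rightarrow> (real \<Rightarrow> complex) \<Rightarrow> real \<Rightarrow> ('a \<Rightarrow> complex) \<Rightarrow> bool" where
  "is_levy_integral M L f T I \<longleftrightarrow>
     I \<in> borel_measurable M \<and>
     (\<forall>n \<tau> c. (\<forall>k::nat. subdivision T (n k) (\<tau> k)) \<longrightarrow>
        uniform_limit {0<..T} (\<lambda>k. step_fun (n k) (\<tau> k) (c k)) f sequentially \<longrightarrow>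
        tendsto_in_prob M (\<lambda>k. step_integral L (n k) (\<tau> k) (c k)) I sequentially)"

text \<open>The integral of \<open>f\<close> over \<open>(0, T]\<close>, as a random variable determined up to null sets.\<close>

definition levy_integral ::
  "'a measure \<Rightarrow> (real \<Rightarrow> 'a \<Rightarrow> real) \<Rightarrow> (real \<Rightarrow> complex) \<Rightarrow> real \<Rightarrow> 'a \<Rightarrow> complex" where
  "levy_integral M L f T = (SOME I. is_levy_integral M L f T I)"

subsection \<open>CARMA coefficients\<close>

text \<open>The coefficients are \<open>a 1, \<dots>, a p\<close> and \<open>b 0, \<dots>, b (p - 1)\<close>; other values are not used.\<close>

definition ar_poly :: "nat \<Rightarrow> (nat \<Rightarrow> real) \<Rightarrow> complex \<Rightarrow> complex" where
  "ar_poly p a z = z ^ p + (\<Sum>k=1..p. complex_of_real (a k) * z ^ (p - k))"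

definition ma_poly :: "nat \<Rightarrow> (nat \<Rightarrow> real) \<Rightarrow> complex \<Rightarrow> complex" where
  "ma_poly p b z = (\<Sum>j<p. complex_of_real (b j) * z ^ j)"

definition companion :: "nat \<Rightarrow> (nat \<Rightarrow> real) \<Rightarrow> real mat" where
  "companion p a = Matrix.mat p p (\<lambda>(i, j).
     if i = p - 1 then - a (p - j) else if j = i + 1 then 1 else 0)"

definition scaled_transform ::
  "'a measure \<Rightarrow> (real \<Rightarrow> 'a \<Rightarrow> real) \<Rightarrow> nat \<Rightarrow> (nat \<Rightarrow> real) \<Rightarrow> (nat \<Rightarrow> real) \<Rightarrow> real \<Rightarrow> real \<Rightarrow> 'a \<Rightarrow> complex"
where
  "scaled_transform M L p a b \<omega> T x =
     complex_of_real (1 / sqrt T) * (ma_poly p b (\<i> * \<omega>) / ar_poly p a (\<i> * \<omega>)) *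
     levy_integral M L (\<lambda>t. exp (- (\<i> * \<omega> * t))) T x"

end

theory Submission
  imports Defs
begin

text \<open>Why the theorem holds. Let \<open>\<tau> = 2\<pi>/\<omega>\<close> be the period of the integrand. The contributions of successive
periods to \<open>\<integral> e\<^sup>-\<^sup>i\<^sup>\<omega>\<^sup>t dL(t)\<close> are independent and identically distributed, centred, and of finite
variance, so the normalised integral is asymptotically normal. In any fixed direction of the plane the
integrand is a multiple of a shifted cosine, whose square has mean \<open>1/2\<close> over a period whatever the shift;
so the limiting covariance is a multiple of the identity, and the constant \<open>c = b(i\<omega>)/a(i\<omega>)\<close> only
contributes the factor \<open>\<bar>c\<bar>\<^sup>2\<close>.

The proof works with characteristic functions. The continuity theorem in several dimensions
(\<open>tendsto_in_distribution_of_char\<close>) reduces the claim to their convergence together with tightness. The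
quantitative tool is the isometry \<open>increment_sum_isometry\<close>: second moments of sums of weighted increments
are \<open>\<sigma>\<^sup>2\<close> times squared \<open>L\<^sup>2\<close> norms of the corresponding step functions. It rests on
\<open>E (L s L t) = \<sigma>\<^sup>2 min s t\<close>, which has to be derived from the moments at time 1 (\<open>covariance\<close>), and it
yields the existence of the integral (\<open>ex_is_levy_integral\<close>), the tail bound \<open>levy_integral_tail\<close> that
gives tightness, and an estimate of the error made in replacing the integral up to time \<open>T\<close> by a
Riemann sum over full periods with a fixed number \<open>m\<close> of points per period (\<open>levy_integral_char_dist\<close>).

The Riemann sum is a weighted sum of independent, identically distributed increments with weights that
repeat after \<open>m\<close> terms. Its characteristic function is a product of \<open>m\<close> factors, each the \<open>N\<close>-th power of
a characteristic function at an argument of order \<open>N\<^sup>-\<^sup>1\<^sup>/\<^sup>2\<close>, where \<open>N\<close> counts the periods; such powers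
converge to Gaussian factors (\<open>char_power_tendsto\<close>). For \<open>m \<ge> 3\<close> the product of the limits is already the
characteristic function of the claimed normal law, because the sum of the squared weights is evaluated
exactly by a sum over roots of unity (\<open>sum_Re_roots_of_unity_squared\<close>). The replacement error is uniform in
\<open>T\<close> and vanishes as \<open>m\<close> grows.\<close>

section \<open>Weak convergence from characteristic functions\<close>

text \<open>Finite linear combinations of plane waves. They form an algebra, contain enough functions for the
Stone--Weierstrass theorem, are bounded on the whole space, and their expectations are linear
combinations of values of the characteristic function.\<close>

inductive trig_poly :: "('a::real_inner \<Rightarrow> complex) \<Rightarrow> bool" where
  wave: "trig_poly (\<lambda>x. c * cis (inner u x))"
| add: "trig_poly P \<Longrightarrow> trig_poly Q \<Longrightarrow> trig_poly (\<lambda>x. P x + Q x)"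

lemma trig_poly_const: "trig_poly (\<lambda>x::'a::real_inner. c)"
  using trig_poly.wave[of c "0::'a"] by simp

lemma trig_poly_mult:
  assumes "trig_poly P" "trig_poly Q"
  shows "trig_poly (\<lambda>x. P x * Q x)"
  using assms(1)
proof induction
  case (wave c u)
  from assms(2) show ?case
  proof induction
    case (wave d v)
    have "(\<lambda>x. c * cis (inner u x) * (d * cis (inner v x))) = (\<lambda>x. c * d * cis (inner (u + v) x))"
      by (simp add: fun_eq_iff inner_add_left mult_ac cis_mult)
    then show ?case by (simp only:) (rule trig_poly.wave)
  next
    case (add P Q)
    then show ?case unfolding distrib_left by (intro trig_poly.add)
  qed
next
  case (add P Q)
  then show ?case unfolding distrib_right by (intro trig_poly.add)
qed

lemma trig_poly_sin: "trig_poly (\<lambda>x. complex_of_real (sin (inner u x)))"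
proof -
  have "(\<lambda>x. complex_of_real (sin (inner u x)))
      = (\<lambda>x. (- \<i> / 2) * cis (inner u x) + (\<i> / 2) * cis (inner (- u) x))"
    by (auto simp: fun_eq_iff complex_eq_iff)
  then show ?thesis by (simp only:) (intro trig_poly.intros)
qed

lemma trig_poly_continuous: "trig_poly P \<Longrightarrow> continuous_on UNIV P"
  by (induction rule: trig_poly.induct) (auto intro!: continuous_intros)

lemma trig_poly_bounded: "trig_poly P \<Longrightarrow> \<exists>B. \<forall>x. cmod (P x) \<le> B"
proof (induction rule: trig_poly.induct)
  case (wave c u)
  show ?case by (rule exI[of _ "cmod c"]) (simp add: norm_mult)
next
  case (add P Q)
  then obtain A B where "\<forall>x. cmod (P x) \<le> A" "\<forall>x. cmod (Q x) \<le> B" by blast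
  then have "\<forall>x. cmod (P x + Q x) \<le> A + B" by (auto intro: norm_triangle_mono)
  then show ?case by blast
qed

lemma trig_poly_integrable:
  fixes X :: "'a \<Rightarrow> 'b::euclidean_space"
  assumes "prob_space M" "X \<in> borel_measurable M" "trig_poly P"
  shows "integrable M (\<lambda>x. P (X x))"
proof -
  interpret prob_space M by fact
  obtain B where "\<forall>x. cmod (P x) \<le> B" using trig_poly_bounded[OF assms(3)] by blast
  moreover have "(\<lambda>x. P (X x)) \<in> borel_measurable M"
    by (rule borel_measurable_continuous_on[OF trig_poly_continuous[OF assms(3)] assms(2)])
  ultimately show ?thesis by (intro integrable_const_bound[where B=B]) auto
qed

lemma trig_poly_expectation_tendsto:
  fixes X :: "'i \<Rightarrow> 'a \<Rightarrow> 'b::euclidean_space"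
  assumes M: "prob_space M" and N: "prob_space N" "sets N = sets borel"
    and meas: "\<forall>\<^sub>F i in G. X i \<in> borel_measurable M"
    and cf: "\<And>u. ((\<lambda>i. \<integral>x. cis (inner u (X i x)) \<partial>M) \<longlongrightarrow> (\<integral>y. cis (inner u y) \<partial>N)) G"
    and P: "trig_poly P"
  shows "((\<lambda>i. \<integral>x. P (X i x) \<partial>M) \<longlongrightarrow> (\<integral>y. P y \<partial>N)) G"
  using P
proof induction
  case (wave c u)
  show ?case using tendsto_mult_left[OF cf] by simp
next
  case (add P Q)
  have idN: "(\<lambda>x. x) \<in> borel_measurable N" by (simp add: measurable_ident_sets N)
  note N_int = trig_poly_integrable[OF N(1) idN]
  have "((\<lambda>i. (\<integral>x. P (X i x) \<partial>M) + (\<integral>x. Q (X i x) \<partial>M)) \<longlongrightarrow> (\<integral>y. P y \<partial>N) + (\<integral>y. Q y \<partial>N)) G"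
    by (intro tendsto_add add)
  moreover have "\<forall>\<^sub>F i in G. (\<integral>x. P (X i x) \<partial>M) + (\<integral>x. Q (X i x) \<partial>M) = (\<integral>x. P (X i x) + Q (X i x) \<partial>M)"
    using meas
  proof eventually_elim
    case (elim i)
    show ?case
      by (rule Bochner_Integration.integral_add[symmetric])
        (use trig_poly_integrable[OF M elim] add in blast)+
  qed
  moreover have "(\<integral>y. P y \<partial>N) + (\<integral>y. Q y \<partial>N) = (\<integral>y. P y + Q y \<partial>N)"
    by (rule Bochner_Integration.integral_add[symmetric]) (use N_int add in blast)+
  ultimately show ?case by (simp add: Lim_transform_eventually)
qed

text \<open>The form in which an approximation on a large ball is used: outside the ball only the sup norms
matter, and they are weighted with the probability of leaving the ball.\<close>

lemma expectation_diff_le_of_close: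
  fixes f P :: "'b::euclidean_space \<Rightarrow> real"
  assumes M: "prob_space M" and X: "X \<in> borel_measurable M"
    and f: "f \<in> borel_measurable borel" "\<And>y. \<bar>f y\<bar> \<le> B" and P: "P \<in> borel_measurable borel" "\<And>y. \<bar>P y\<bar> \<le> C"
    and close: "\<And>y. norm y \<le> R \<Longrightarrow> \<bar>f y - P y\<bar> \<le> \<epsilon>" and "\<epsilon> \<ge> 0"
  shows "\<bar>(\<integral>x. f (X x) \<partial>M) - (\<integral>x. P (X x) \<partial>M)\<bar>
    \<le> \<epsilon> + (B + C) * measure M {x \<in> space M. norm (X x) > R}"
proof -
  interpret prob_space M by fact
  note [measurable] = X f(1) P(1)
  let ?A = "{x \<in> space M. norm (X x) > R}"
  have [measurable]: "?A \<in> sets M" by measurable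
  have If: "integrable M (\<lambda>x. f (X x))"
    by (rule integrable_const_bound[where B=B]) (use f in auto)
  have IP: "integrable M (\<lambda>x. P (X x))"
    by (rule integrable_const_bound[where B=C]) (use P in auto)
  have I1: "integrable M (\<lambda>x. (B + C) * indicator ?A x)"
    by (intro integrable_mult_right integrable_real_indicator) (simp_all add: less_top[symmetric])
  have "\<bar>(\<integral>x. f (X x) \<partial>M) - (\<integral>x. P (X x) \<partial>M)\<bar> = \<bar>\<integral>x. f (X x) - P (X x) \<partial>M\<bar>"
    using If IP by simp
  also have "\<dots> \<le> (\<integral>x. \<epsilon> + (B + C) * indicator ?A x \<partial>M)"
  proof (rule order_trans[OF integral_abs_bound], rule integral_mono)
    show "integrable M (\<lambda>x. \<bar>f (X x) - P (X x)\<bar>)" using If IP by simp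
    show "integrable M (\<lambda>x. \<epsilon> + (B + C) * indicator ?A x)"
      using I1 by (intro Bochner_Integration.integrable_add integrable_const)
    fix x assume x: "x \<in> space M"
    show "\<bar>f (X x) - P (X x)\<bar> \<le> \<epsilon> + (B + C) * indicator ?A x"
    proof (cases "norm (X x) \<le> R")
      case True
      then show ?thesis using close[OF True] by simp
    next
      case False
      then have "indicator ?A x = (1::real)" using x by simp
      moreover have "\<bar>f (X x) - P (X x)\<bar> \<le> \<epsilon> + (B + C)"
        using f(2)[of "X x"] P(2)[of "X x"] \<open>\<epsilon> \<ge> 0\<close> by linarith
      ultimately show ?thesis by simp
    qed
  qed
  also have "\<dots> = \<epsilon> + (B + C) * measure M ?A"
    using I1 by (simp add: prob_space)
  finally show ?thesis .
qed

text \<open>A polynomial approximation on a ball would be unbounded outside of it. Substituting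
\<open>sin (x\<^sub>i / R)\<close> for the coordinates cures this: the substitution maps the whole space into a cube,
is invertible for \<open>\<bar>x\<^sub>i\<bar> \<le> R\<close> by means of \<open>arcsin\<close>, and turns polynomials into trigonometric
polynomials. An approximation on the cube therefore is bounded everywhere and close to \<open>f\<close> on
the ball.\<close>

lemma trig_poly_approx:
  fixes f :: "real ^ 'n \<Rightarrow> real"
  assumes f: "continuous_on UNIV f" "\<And>y. \<bar>f y\<bar> \<le> B" and "R > 0" "\<epsilon> > 0"
  obtains P where "trig_poly (\<lambda>x. complex_of_real (P x))"
    "\<And>x. \<bar>P x\<bar> \<le> B + \<epsilon>" "\<And>x. norm x \<le> R \<Longrightarrow> \<bar>f x - P x\<bar> \<le> \<epsilon>"
proof -
  define S :: "(real ^ 'n) set" where "S = cbox (\<chi> i. -1) (\<chi> i. 1)"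
  have memS: "y \<in> S \<longleftrightarrow> (\<forall>i. \<bar>y $ i\<bar> \<le> 1)" for y
    unfolding S_def mem_box_cart vec_lambda_beta by (intro all_cong1) arith
  define e :: "real ^ 'n \<Rightarrow> real ^ 'n" where "e x = (\<chi> i. sin (x $ i / R))" for x
  \<comment> \<open>The function that corresponds to \<open>f\<close> on the cube \<open>S\<close>; it has the same bound as \<open>f\<close>.\<close>
  define H where "H y = f (\<chi> i. R * arcsin (y $ i))" for y
  have eS: "e x \<in> S" for x by (simp add: memS e_def)
  have H_e: "H (e x) = f x" if "norm x \<le> R" for x
  proof -
    have "arcsin (sin (x $ i / R)) = x $ i / R" for i
    proof (rule arcsin_sin)
      have "\<bar>x $ i\<bar> \<le> R" using that component_le_norm_cart[of x i] by linarith
      then have "\<bar>x $ i / R\<bar> \<le> 1" using \<open>R > 0\<close> by simp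
      then show "- (pi / 2) \<le> x $ i / R" "x $ i / R \<le> pi / 2"
        using pi_gt3 by linarith+
    qed
    then show ?thesis using \<open>R > 0\<close> by (simp add: H_def e_def)
  qed
  have H_cont: "continuous_on S H"
    unfolding H_def
  proof (rule continuous_on_compose2[OF f(1)])
    show "continuous_on S (\<lambda>y. \<chi> i. R * arcsin (y $ i))"
      by (intro continuous_intros) (auto simp: memS abs_le_iff)
  qed auto
  have H_bd: "\<bar>H y\<bar> \<le> B" for y using f(2) by (simp add: H_def)
  define Pr where "Pr g \<longleftrightarrow> continuous_on UNIV g \<and> trig_poly (\<lambda>x. complex_of_real (g (e x)))"
    for g :: "real ^ 'n \<Rightarrow> real"
  have coord: "Pr (\<lambda>y. y $ i)" for i
  proof -
    have "trig_poly (\<lambda>x. complex_of_real (e x $ i))"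
      using trig_poly_sin[of "(1 / R) *\<^sub>R axis i (1::real)"] by (simp add: e_def inner_axis')
    then show ?thesis unfolding Pr_def by (intro conjI continuous_intros)
  qed
  have "\<exists>g. Pr g \<and> (\<forall>y\<in>S. \<bar>H y - g y\<bar> < \<epsilon>)"
  proof (rule Stone_Weierstrass_HOL[where P = Pr])
    show "compact S" by (simp add: S_def compact_cbox)
    show "Pr (\<lambda>x. c)" for c by (simp add: trig_poly_const Pr_def)
    show "continuous_on S f" if "Pr f" for f using that continuous_on_subset unfolding Pr_def by blast
    show "Pr (\<lambda>x. f x + g x)" if "Pr f \<and> Pr g" for f g
      using that unfolding Pr_def of_real_add by (intro conjI continuous_intros trig_poly.add) blast+
    show "Pr (\<lambda>x. f x * g x)" if "Pr f \<and> Pr g" for f g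
      using that unfolding Pr_def of_real_mult by (intro conjI continuous_intros trig_poly_mult) blast+
    show "\<exists>g. Pr g \<and> g x \<noteq> g y" if "x \<in> S \<and> y \<in> S \<and> x \<noteq> y" for x y
    proof -
      from that obtain i where "x $ i \<noteq> y $ i" by (auto simp: Finite_Cartesian_Product.vec_eq_iff)
      then show ?thesis using coord[of i] by blast
    qed
  qed (fact H_cont, fact \<open>\<epsilon> > 0\<close>)
  then obtain g where g: "Pr g" "\<And>y. y \<in> S \<Longrightarrow> \<bar>H y - g y\<bar> < \<epsilon>" by blast
  show ?thesis
  proof (rule that[of "\<lambda>x. g (e x)"])
    show "trig_poly (\<lambda>x. complex_of_real (g (e x)))" using g unfolding Pr_def by blast
    show "\<bar>g (e x)\<bar> \<le> B + \<epsilon>" for x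
      using g(2)[OF eS, of x] H_bd[of "e x"] by linarith
    show "\<bar>f x - g (e x)\<bar> \<le> \<epsilon>" if "norm x \<le> R" for x
      using g(2)[OF eS, of x] H_e[OF that] by linarith
  qed
qed

text \<open>Continuity of the measure along the complements of the balls with integer radii.\<close>

lemma prob_tight:
  fixes N :: "'b::real_normed_vector measure"
  assumes N: "prob_space N" "sets N = sets borel" and "\<epsilon> > 0"
  obtains R where "R > 0" "measure N {y \<in> space N. norm y > R} < \<epsilon>"
proof -
  interpret prob_space N by fact
  have sp: "space N = UNIV" using sets_eq_imp_space_eq[OF N(2)] by simp
  let ?A = "\<lambda>n::nat. {y \<in> space N. norm y > real n}"
  have "(\<lambda>n. measure N (?A n)) \<longlonglongrightarrow> measure N (\<Inter>n. ?A n)"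
    by (rule finite_Lim_measure_decseq) (auto simp: N sp decseq_def intro!: borel_open open_Collect_less continuous_intros)
  moreover have "(\<Inter>n. ?A n) = {}"
  proof (intro equalityI subsetI)
    fix y assume y: "y \<in> (\<Inter>n. ?A n)"
    obtain n where "norm y \<le> real n" using real_arch_simple by blast
    moreover have "norm y > real n" using y by blast
    ultimately show "y \<in> {}" by simp
  qed simp
  ultimately have "(\<lambda>n. measure N (?A n)) \<longlonglongrightarrow> 0" by simp
  from order_tendstoD(2)[OF this \<open>\<epsilon> > 0\<close>] eventually_gt_at_top[of 0]
  have "\<forall>\<^sub>F n in sequentially. measure N (?A n) < \<epsilon> \<and> n > 0" by eventually_elim simp
  then obtain n where "measure N (?A n) < \<epsilon>" "n > 0" by (auto simp: eventually_sequentially)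
  then show ?thesis by (intro that[of "real n"]) auto
qed

text \<open>The direction of Levy's continuity theorem that is needed, in any finite dimension: characteristic
functions control expectations of trigonometric polynomials, tightness and the previous approximation
carry this over to bounded continuous functions.\<close>

lemma tendsto_in_distribution_of_char:
  fixes X :: "'i \<Rightarrow> 'a \<Rightarrow> real ^ 'n"
  assumes M: "prob_space M" and N: "prob_space N" "sets N = sets borel"
    and meas: "\<forall>\<^sub>F i in G. X i \<in> borel_measurable M"
    and cf: "\<And>u. ((\<lambda>i. \<integral>x. cis (inner u (X i x)) \<partial>M) \<longlongrightarrow> (\<integral>y. cis (inner u y) \<partial>N)) G"
    and tight: "\<And>\<epsilon>. \<epsilon> > 0 \<Longrightarrow> \<exists>R. \<forall>\<^sub>F i in G. measure M {x \<in> space M. norm (X i x) > R} < \<epsilon>"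
  shows "tendsto_in_distribution M X N G"
  unfolding tendsto_in_distribution_def
proof (intro conjI allI impI meas N)
  fix f :: "real ^ 'n \<Rightarrow> real" assume f: "continuous_on UNIV f" and "bounded (range f)"
  then obtain B where B: "B > 0" "\<And>y. \<bar>f y\<bar> \<le> B"
    by (auto simp: bounded_pos)
  have idN: "(\<lambda>x. x) \<in> borel_measurable N" by (simp add: measurable_ident_sets N)
  have spN: "space N = UNIV" using sets_eq_imp_space_eq[OF N(2)] by simp
  interpret M: prob_space M by fact
  show "((\<lambda>i. \<integral>x. f (X i x) \<partial>M) \<longlongrightarrow> (\<integral>y. f y \<partial>N)) G"
  proof (rule tendstoI)
    fix e :: real assume "e > 0"
    \<comment> \<open>The three approximation errors add up to at most \<open>\<epsilon> * (5 + 4 * B)\<close> when \<open>\<epsilon> \<le> 1\<close>.\<close>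
    define \<epsilon> where "\<epsilon> = min 1 (e / (2 * (5 + 4 * B)))"
    have "\<epsilon> > 0" "\<epsilon> \<le> 1" using \<open>e > 0\<close> B by (auto simp: \<epsilon>_def)
    have "\<epsilon> * (5 + 4 * B) \<le> e / (2 * (5 + 4 * B)) * (5 + 4 * B)"
      using B by (intro mult_right_mono) (auto simp: \<epsilon>_def)
    also have "\<dots> = e / 2" using B by (simp add: divide_simps)
    finally have \<epsilon>: "\<epsilon> * (5 + 4 * B) < e" using \<open>e > 0\<close> by simp
    obtain R1 where R1: "\<forall>\<^sub>F i in G. measure M {x \<in> space M. norm (X i x) > R1} < \<epsilon>"
      using tight[OF \<open>\<epsilon> > 0\<close>] by blast
    obtain R2 where R2: "R2 > 0" "measure N {y \<in> space N. norm y > R2} < \<epsilon>"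
      using prob_tight[OF N \<open>\<epsilon> > 0\<close>] by blast
    define R where "R = max R1 R2"
    have "R > 0" using R2 by (simp add: R_def)
    obtain P where P: "trig_poly (\<lambda>x. complex_of_real (P x))"
      "\<And>x. \<bar>P x\<bar> \<le> B + \<epsilon>" "\<And>x. norm x \<le> R \<Longrightarrow> \<bar>f x - P x\<bar> \<le> \<epsilon>"
      using trig_poly_approx[OF f B(2) \<open>R > 0\<close> \<open>\<epsilon> > 0\<close>] by blast
    have Pm: "P \<in> borel_measurable borel"
    proof -
      have "continuous_on UNIV (\<lambda>x. Re (complex_of_real (P x)))"
        by (intro continuous_intros trig_poly_continuous[OF P(1)])
      then show ?thesis by (simp add: borel_measurable_continuous_onI)
    qed
    have fm: "f \<in> borel_measurable borel" using f by (rule borel_measurable_continuous_onI)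
    have Re_int: "(\<integral>x. P (Y x) \<partial>K) = Re (\<integral>x. complex_of_real (P (Y x)) \<partial>K)" for K :: "'c measure" and Y
      by simp
    have "((\<lambda>i. \<integral>x. P (X i x) \<partial>M) \<longlongrightarrow> (\<integral>y. P y \<partial>N)) G"
      unfolding Re_int by (intro tendsto_Re trig_poly_expectation_tendsto[OF M N meas cf P(1)])
    then have "\<forall>\<^sub>F i in G. dist (\<integral>x. P (X i x) \<partial>M) (\<integral>y. P y \<partial>N) < \<epsilon>"
      using \<open>\<epsilon> > 0\<close> by (rule tendstoD)
    then show "\<forall>\<^sub>F i in G. dist (\<integral>x. f (X i x) \<partial>M) (\<integral>y. f y \<partial>N) < e"
      using R1 meas
    proof eventually_elim
      case (elim i)
      note [measurable] = \<open>X i \<in> borel_measurable M\<close>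
      have "measure M {x \<in> space M. norm (X i x) > R} \<le> measure M {x \<in> space M. norm (X i x) > R1}"
        by (rule M.finite_measure_mono) (auto simp: R_def)
      then have *: "measure M {x \<in> space M. norm (X i x) > R} \<le> \<epsilon>" using elim by simp
      have "measure N {x \<in> space N. norm x > R} \<le> measure N {x \<in> space N. norm x > R2}"
        by (rule finite_measure.finite_measure_mono)
          (auto simp: R_def N spN intro!: prob_space.finite_measure borel_open open_Collect_less continuous_intros)
      then have **: "measure N {x \<in> space N. norm x > R} \<le> \<epsilon>" using R2 by simp
      have a: "\<bar>(\<integral>x. f (X i x) \<partial>M) - (\<integral>x. P (X i x) \<partial>M)\<bar> \<le> \<epsilon> + (B + (B + \<epsilon>)) * \<epsilon>"
        by (rule order_trans[OF expectation_diff_le_of_close[OF M elim(3) fm B(2) Pm P(2,3)]])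
          (use * \<open>\<epsilon> > 0\<close> B in \<open>auto intro!: mult_left_mono\<close>)
      have b: "\<bar>(\<integral>x. f x \<partial>N) - (\<integral>x. P x \<partial>N)\<bar> \<le> \<epsilon> + (B + (B + \<epsilon>)) * \<epsilon>"
        by (rule order_trans[OF expectation_diff_le_of_close[OF N(1) idN fm B(2) Pm P(2,3)]])
          (use ** \<open>\<epsilon> > 0\<close> B in \<open>auto intro!: mult_left_mono\<close>)
      have "\<epsilon> * \<epsilon> \<le> \<epsilon> * 1" using \<open>\<epsilon> > 0\<close> \<open>\<epsilon> \<le> 1\<close> by (intro mult_left_mono) auto
      then have "2 * (\<epsilon> + (B + (B + \<epsilon>)) * \<epsilon>) + \<epsilon> \<le> \<epsilon> * (5 + 4 * B)"
        by (simp add: algebra_simps)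
      then have c: "2 * (\<epsilon> + (B + (B + \<epsilon>)) * \<epsilon>) + \<epsilon> < e" using \<epsilon> by (rule le_less_trans)
      have triangle: "dist s t < e"
        if "\<bar>s - s'\<bar> \<le> K" "\<bar>t - t'\<bar> \<le> K" "dist s' t' < \<epsilon>" "2 * K + \<epsilon> < e" for s s' t t' K :: real
        using that unfolding dist_real_def by linarith
      show ?case by (rule triangle[OF a b elim(1) c])
    qed
  qed
qed

section \<open>Characteristic functions of normal vectors\<close>

lemma prod_Basis_vec:
  fixes h :: "'n::finite \<Rightarrow> real \<Rightarrow> 'c::comm_monoid_mult" and x :: "real ^ 'n"
  shows "(\<Prod>b\<in>Basis. h (axis_index b) (x \<bullet> b)) = (\<Prod>i\<in>UNIV. h i (x $ i))"
proof -
  let ?e = "\<lambda>i::'n. axis i (1::real)"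
  have inj: "inj ?e" by (auto simp: inj_on_def axis_eq_axis)
  have "(\<Prod>b\<in>Basis. h (axis_index b) (x \<bullet> b)) = (\<Prod>b\<in>range ?e. h (axis_index b) (x \<bullet> b))"
    by (rule prod.cong) (auto simp: Basis_vec_def)
  also have "\<dots> = (\<Prod>i\<in>UNIV. h i (x $ i))"
    by (simp add: prod.reindex[OF inj] axis_index_axis inner_axis)
  finally show ?thesis .
qed

lemma prod_Basis_vec_const:
  fixes h :: "'n::finite \<Rightarrow> 'c::comm_monoid_mult"
  shows "(\<Prod>b\<in>(Basis :: (real ^ 'n) set). h (axis_index b)) = (\<Prod>i\<in>UNIV. h i)"
  using prod_Basis_vec[of "\<lambda>i _. h i" 0] by simp

text \<open>Lebesgue measure is the image of a product measure indexed by the standard basis, so Fubini's theorem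
for finite products applies; the previous two lemmas translate between basis vectors and indices.\<close>

lemma integral_lborel_prod_components:
  fixes g :: "'n::finite \<Rightarrow> real \<Rightarrow> complex"
  assumes "\<And>i. integrable lborel (g i)"
  shows "(\<integral>x. (\<Prod>i\<in>UNIV. g i (x $ i)) \<partial>(lborel :: (real ^ 'n) measure)) = (\<Prod>i\<in>UNIV. \<integral>t. g i t \<partial>lborel)"
proof -
  interpret product_sigma_finite "\<lambda>b::real ^ 'n. interval_measure (\<lambda>x. x)"
    unfolding lborel_eq_real[symmetric] by standard
  have int: "integrable (interval_measure (\<lambda>x. x)) (g i)" for i
    using assms by (simp add: lborel_eq_real)
  have [measurable]: "g i \<in> borel_measurable borel" for i using int[of i] by auto
  have "(\<integral>x. (\<Prod>i\<in>UNIV. g i (x $ i)) \<partial>(lborel :: (real ^ 'n) measure))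
    = (\<integral>x. (\<Prod>b\<in>Basis. g (axis_index b) (x \<bullet> b)) \<partial>(lborel :: (real ^ 'n) measure))"
    by (simp only: prod_Basis_vec)
  also have "\<dots> = (\<integral>y. (\<Prod>b\<in>(Basis :: (real ^ 'n) set). g (axis_index b) (y b)) \<partial>(\<Pi>\<^sub>M b\<in>Basis. interval_measure (\<lambda>x. x)))"
    unfolding lborel_def
    by (subst integral_distr) (auto intro!: Bochner_Integration.integral_cong prod.cong)
  also have "\<dots> = (\<Prod>b\<in>(Basis :: (real ^ 'n) set). \<integral>t. g (axis_index b) t \<partial>interval_measure (\<lambda>x. x))"
    by (rule product_integral_prod) (use int in auto)
  also have "\<dots> = (\<Prod>i\<in>UNIV. \<integral>t. g i t \<partial>lborel)"
    by (subst prod_Basis_vec_const) (simp add: lborel_eq_real)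
  finally show ?thesis .
qed

lemma sets_std_normal_vector [simp]: "sets std_normal_vector = sets borel"
  by (simp add: std_normal_vector_def)

lemma prob_space_std_normal_vector: "prob_space (std_normal_vector :: (real ^ 'n) measure)"
proof
  have "emeasure std_normal_vector (space (std_normal_vector :: (real ^ 'n) measure))
    = (\<integral>\<^sup>+x. ennreal (\<Prod>i\<in>UNIV. normal_density 0 1 (x $ i)) \<partial>(lborel :: (real ^ 'n) measure))"
    by (simp add: std_normal_vector_def emeasure_density)
  also have "\<dots> = (\<integral>\<^sup>+x. (\<Prod>b\<in>Basis. ennreal (normal_density 0 1 (x \<bullet> b))) \<partial>(lborel :: (real ^ 'n) measure))"
    by (simp only: prod_Basis_vec[of "\<lambda>_. std_normal_density", symmetric] prod_ennreal normal_density_nonneg)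
  also have "\<dots> = (\<Prod>b\<in>(Basis :: (real ^ 'n) set). \<integral>\<^sup>+t. ennreal (normal_density 0 1 t) \<partial>lborel)"
    by (rule nn_integral_lborel_prod) auto
  also have "\<dots> = 1"
    using prob_space.emeasure_space_1[OF prob_space_normal_density[of 1 0]]
    by (simp add: emeasure_density)
  finally show "emeasure std_normal_vector (space (std_normal_vector :: (real ^ 'n) measure)) = 1" .
qed

text \<open>Density and plane wave both factor over the coordinates, which reduces the claim to the
one-dimensional standard normal distribution.\<close>

lemma char_std_normal_vector:
  fixes v :: "real ^ 'n"
  shows "(\<integral>x. cis (inner v x) \<partial>std_normal_vector) = exp (- ((norm v)\<^sup>2 / 2))"
proof -
  have int: "integrable lborel (\<lambda>t. normal_density 0 1 t *\<^sub>R cis (s * t))" for s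
  proof -
    have "integrable lborel (normal_density 0 1)" by simp
    then show ?thesis
      by (rule Bochner_Integration.integrable_bound) (auto simp: cis_conv_exp)
  qed
  have cis_sum: "cis (sum f A) = (\<Prod>i\<in>A. cis (f i))" if "finite A" for f :: "'n \<Rightarrow> real" and A
    using that by (induction A) (auto simp: cis_mult[symmetric])
  have "(\<integral>x. cis (inner v x) \<partial>std_normal_vector)
    = (\<integral>x. (\<Prod>i\<in>UNIV. normal_density 0 1 (x $ i)) *\<^sub>R cis (inner v x) \<partial>lborel)"
    unfolding std_normal_vector_def
    by (subst integral_density)
      (auto intro!: prod_nonneg borel_measurable_continuous_onI continuous_intros)
  also have "\<dots> = (\<integral>x. (\<Prod>i\<in>UNIV. normal_density 0 1 (x $ i) *\<^sub>R cis (v $ i * x $ i)) \<partial>lborel)"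
    by (simp add: inner_vec_def cis_sum scaleR_conv_of_real prod.distrib)
  also have "\<dots> = (\<Prod>i\<in>UNIV. \<integral>t. normal_density 0 1 t *\<^sub>R cis (v $ i * t) \<partial>lborel)"
    by (rule integral_lborel_prod_components) (rule int)
  also have "\<dots> = (\<Prod>i\<in>UNIV. char std_normal_distribution (v $ i))"
    by (simp add: char_def integral_density cis_conv_exp)
  also have "\<dots> = (\<Prod>i\<in>UNIV. complex_of_real (exp (- ((v $ i)\<^sup>2) / 2)))"
    by (simp only: char_std_normal_distribution)
  also have "\<dots> = complex_of_real (exp (\<Sum>i\<in>UNIV. - ((v $ i)\<^sup>2) / 2))"
    by (simp add: exp_sum del: of_real_exp)
  also have "(\<Sum>i\<in>UNIV. - ((v $ i)\<^sup>2) / 2) = - ((norm v)\<^sup>2 / 2)"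
    by (simp add: power2_norm_eq_inner inner_vec_def sum_negf flip: sum_divide_distrib power2_eq_square)
  finally show ?thesis by (simp add: exp_of_real)
qed

text \<open>The square root chosen in the definition of the normal distribution is any matrix with the right
Gram matrix; the scaled identity shows that there is one.\<close>

lemma mv_normal_root:
  assumes s: "s \<ge> 0"
  defines "S \<equiv> (SOME S :: real ^ 'n ^ 'n. S ** Finite_Cartesian_Product.transpose S = s *\<^sub>R Finite_Cartesian_Product.mat 1)"
  shows "S ** Finite_Cartesian_Product.transpose S = s *\<^sub>R Finite_Cartesian_Product.mat 1"
  unfolding S_def
proof (rule someI_ex, rule exI)
  show "(sqrt s *\<^sub>R Finite_Cartesian_Product.mat 1 :: real ^ 'n ^ 'n) ** Finite_Cartesian_Product.transpose (sqrt s *\<^sub>R Finite_Cartesian_Product.mat 1)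
    = s *\<^sub>R Finite_Cartesian_Product.mat 1"
    using s by (simp add: transpose_scalar matrix_scalar_ac scalar_matrix_assoc[symmetric])
qed

lemma prob_space_mv_normal: "prob_space (mv_normal \<mu> \<Sigma>)"
  unfolding mv_normal_def
  by (intro prob_space.prob_space_distr prob_space_std_normal_vector)
    (auto intro!: borel_measurable_continuous_onI continuous_intros simp: measurable_cong_sets[OF sets_std_normal_vector])

text \<open>The chosen root \<open>S\<close> enters only through \<open>inner u (S *v (transpose S *v u))\<close>, hence only through the
covariance matrix.\<close>

lemma char_mv_normal_scaled_mat_1:
  fixes u :: "real ^ 'n"
  assumes s: "s \<ge> 0"
  shows "(\<integral>y. cis (inner u y) \<partial>mv_normal 0 (s *\<^sub>R Finite_Cartesian_Product.mat 1)) = exp (- (s * (norm u)\<^sup>2 / 2))"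
proof -
  define S where "S = (SOME S :: real ^ 'n ^ 'n. S ** Finite_Cartesian_Product.transpose S = s *\<^sub>R Finite_Cartesian_Product.mat 1)"
  have S: "S ** Finite_Cartesian_Product.transpose S = s *\<^sub>R Finite_Cartesian_Product.mat 1"
    unfolding S_def by (rule mv_normal_root[OF s])
  let ?v = "Finite_Cartesian_Product.transpose S *v u"
  have "(\<integral>y. cis (inner u y) \<partial>mv_normal 0 (s *\<^sub>R Finite_Cartesian_Product.mat 1)) = (\<integral>x. cis (inner u (S *v x)) \<partial>std_normal_vector)"
    unfolding mv_normal_def S_def[symmetric]
    by (subst integral_distr)
      (auto intro!: borel_measurable_continuous_onI continuous_intros simp: measurable_cong_sets[OF sets_std_normal_vector])
  also have "\<dots> = (\<integral>x. cis (inner ?v x) \<partial>std_normal_vector)"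
    by (simp add: dot_lmul_matrix)
  also have "\<dots> = exp (- ((norm ?v)\<^sup>2 / 2))" by (rule char_std_normal_vector)
  also have "(norm ?v)\<^sup>2 = inner u (S *v ?v)"
    by (simp add: power2_norm_eq_inner dot_lmul_matrix)
  also have "S *v ?v = s *\<^sub>R u"
    by (simp only: matrix_vector_mul_assoc S flip: scaleR_matrix_vector_assoc) simp
  finally show ?thesis by (simp add: power2_norm_eq_inner)
qed

section \<open>Moments of a square-integrable Levy process\<close>

lemma integrable_mult_of_squares:
  fixes X Y :: "'a \<Rightarrow> real"
  assumes [measurable]: "X \<in> borel_measurable M" "Y \<in> borel_measurable M"
    and "integrable M (\<lambda>x. (X x)\<^sup>2)" "integrable M (\<lambda>x. (Y x)\<^sup>2)"
  shows "integrable M (\<lambda>x. X x * Y x)"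
proof (rule Bochner_Integration.integrable_bound)
  show "integrable M (\<lambda>x. (X x)\<^sup>2 + (Y x)\<^sup>2)" using assms by simp
  have "\<bar>a * b\<bar> \<le> a\<^sup>2 + b\<^sup>2" for a b :: real
  proof -
    have "2 * (\<bar>a\<bar> * \<bar>b\<bar>) \<le> a\<^sup>2 + b\<^sup>2" using sum_squares_bound[of "\<bar>a\<bar>" "\<bar>b\<bar>"] by simp
    moreover have "0 \<le> \<bar>a\<bar> * \<bar>b\<bar>" by simp
    ultimately show ?thesis unfolding abs_mult by linarith
  qed
  then show "AE x in M. norm (X x * Y x) \<le> norm ((X x)\<^sup>2 + (Y x)\<^sup>2)" by simp
qed simp

lemma integrable_square_add:
  fixes X Y :: "'a \<Rightarrow> real"
  assumes [measurable]: "X \<in> borel_measurable M" "Y \<in> borel_measurable M"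
    and "integrable M (\<lambda>x. (X x)\<^sup>2)" "integrable M (\<lambda>x. (Y x)\<^sup>2)"
  shows "integrable M (\<lambda>x. (X x + Y x)\<^sup>2)"
  using integrable_mult_of_squares[OF assms] assms(3,4) by (simp add: power2_sum mult.assoc)

text \<open>Independence makes the joint law a product. By Fubini the translate \<open>X + y\<close> is square integrable for
almost every value \<open>y\<close> of \<open>Y\<close>, and one such \<open>y\<close> is enough. This passes the moment condition
from time 1 to all earlier times.\<close>

lemma (in prob_space) indep_summand_square_integrable:
  fixes X Y :: "'a \<Rightarrow> real"
  assumes ind: "indep_var borel X borel Y" and int: "integrable M (\<lambda>x. (X x + Y x)\<^sup>2)"
  shows "integrable M (\<lambda>x. (X x)\<^sup>2)"
proof -
  have [measurable]: "X \<in> borel_measurable M" "Y \<in> borel_measurable M"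
    using indep_var_rv1[OF ind] indep_var_rv2[OF ind] by auto
  let ?X = "distr M borel X" and ?Y = "distr M borel Y"
  interpret X: prob_space ?X by (rule prob_space_distr) simp
  interpret Y: prob_space ?Y by (rule prob_space_distr) simp
  interpret P: pair_prob_space ?X ?Y ..
  have "(\<integral>\<^sup>+y. \<integral>\<^sup>+x. ennreal ((x + y)\<^sup>2) \<partial>?X \<partial>?Y) = (\<integral>\<^sup>+p. ennreal ((fst p + snd p)\<^sup>2) \<partial>(?X \<Otimes>\<^sub>M ?Y))"
    by (subst P.nn_integral_snd[symmetric]) (auto simp: case_prod_beta)
  also have "?X \<Otimes>\<^sub>M ?Y = distr M (borel \<Otimes>\<^sub>M borel) (\<lambda>x. (X x, Y x))"
    using ind by (simp add: indep_var_distribution_eq)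
  also have "(\<integral>\<^sup>+p. ennreal ((fst p + snd p)\<^sup>2) \<partial>\<dots>) = (\<integral>\<^sup>+x. ennreal ((X x + Y x)\<^sup>2) \<partial>M)"
    by (subst nn_integral_distr) auto
  also have "\<dots> < \<infinity>" using int by (simp add: integrable_iff_bounded)
  finally have "AE y in ?Y. (\<integral>\<^sup>+x. ennreal ((x + y)\<^sup>2) \<partial>?X) \<noteq> \<infinity>"
    by (intro nn_integral_PInf_AE) auto
  then obtain y where "(\<integral>\<^sup>+x. ennreal ((x + y)\<^sup>2) \<partial>?X) \<noteq> \<infinity>"
    using eventually_happens[of _ "ae_filter ?Y"] Y.ae_filter_bot by blast
  then have "(\<integral>\<^sup>+x. ennreal ((x + y)\<^sup>2) \<partial>?X) < \<infinity>" by (simp add: top.not_eq_extremum)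
  then have "integrable M (\<lambda>x. (X x + y)\<^sup>2)"
    by (simp add: nn_integral_distr integrable_iff_bounded)
  then have "integrable M (\<lambda>x. ((X x + y) + (- y))\<^sup>2)"
    by (rule integrable_square_add[rotated 2]) auto
  then show ?thesis by simp
qed

text \<open>Cauchy's functional equation. After subtracting the linear function the remainder vanishes at all
natural numbers, so it is 1-periodic and hence bounded everywhere; but it is also multiplied by
\<open>n\<close> when its argument is.\<close>

lemma additive_bounded_imp_linear:
  fixes g :: "real \<Rightarrow> real"
  assumes add: "\<And>s t. 0 \<le> s \<Longrightarrow> 0 \<le> t \<Longrightarrow> g (s + t) = g s + g t"
    and bd: "\<And>t. 0 \<le> t \<Longrightarrow> t \<le> 1 \<Longrightarrow> \<bar>g t\<bar> \<le> B" and t: "0 \<le> t"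
  shows "g t = t * g 1"
proof (rule ccontr)
  define h where "h s = g s - s * g 1" for s
  have h_add: "h (s + t) = h s + h t" if "0 \<le> s" "0 \<le> t" for s t
    using add[OF that] by (simp add: h_def algebra_simps)
  have h0: "h 0 = 0" using h_add[of 0 0] by simp
  have h_mult: "h (real n * s) = real n * h s" if "0 \<le> s" for n s
    using that by (induction n) (simp_all add: h0 h_add distrib_right)
  have h_nat: "h (real n) = 0" for n using h_mult[of 1 n] by (simp add: h_def)
  have h_bd: "\<bar>h s\<bar> \<le> B + \<bar>g 1\<bar>" if "0 \<le> s" for s
  proof -
    define k where "k = nat \<lfloor>s\<rfloor>"
    have k: "real k \<le> s" "s < real k + 1" using that by (auto simp: k_def)
    have "h s = h (s - real k)" using h_add[of "s - real k" "real k"] k h_nat by simp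
    also have "\<bar>\<dots>\<bar> \<le> \<bar>g (s - real k)\<bar> + \<bar>(s - real k) * g 1\<bar>" unfolding h_def by linarith
    also have "\<dots> \<le> B + 1 * \<bar>g 1\<bar>"
      unfolding abs_mult using k by (intro add_mono bd mult_right_mono) auto
    finally show ?thesis by simp
  qed
  assume "g t \<noteq> t * g 1"
  then have "\<bar>h t\<bar> > 0" by (simp add: h_def)
  from reals_Archimedean3[OF this] obtain n where "B + \<bar>g 1\<bar> < real n * \<bar>h t\<bar>" by blast
  with h_bd[of "real n * t"] t show False by (simp add: h_mult abs_mult)
qed

text \<open>The moment assumptions of the theorem concern time 1 only; the lemmas below extend them to all
times.\<close>

locale square_integrable_levy_process = levy_process M F L
  for M :: "'a measure" and F L +
  fixes \<sigma> :: real
  assumes square_integrable: "integrable M (\<lambda>x. (L 1 x)\<^sup>2)"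
    and centred: "expectation (L 1) = 0"
    and second_moment: "expectation (\<lambda>x. (L 1 x)\<^sup>2) = \<sigma>\<^sup>2"

context levy_process begin

lemma F_measurable_mono:
  assumes "s \<le> t" "X \<in> borel_measurable (F s)"
  shows "X \<in> borel_measurable (F t)"
  using assms sets_F_mono[OF assms(1)] by (auto simp: measurable_def space_F)

lemma F_measurable_imp:
  assumes "X \<in> borel_measurable (F s)"
  shows "X \<in> borel_measurable M"
  using assms sets_F_le[of s] by (auto simp: measurable_def space_F)

lemma L_measurable [measurable]: "0 \<le> t \<Longrightarrow> L t \<in> borel_measurable M"
  using F_measurable_imp[OF adapted] .

lemma indep_var_increment:
  assumes "0 \<le> s" "s \<le> t" and X: "X \<in> borel_measurable (F s)"
  shows "indep_var borel X borel (\<lambda>x. L t x - L s x)"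
proof -
  let ?D = "\<lambda>x. L t x - L s x"
  have meas: "X \<in> borel_measurable M" "?D \<in> borel_measurable M"
    using assms F_measurable_imp[OF X] by auto
  \<comment> \<open>The events of \<open>X\<close> belong to \<open>F s\<close>, and those of the increment form a sigma-algebra already.\<close>
  have sX: "sigma_sets (space M) {X -` A \<inter> space M |A. A \<in> sets borel} \<subseteq> sets (F s)"
    using sets.sigma_sets_subset[of "{X -` A \<inter> space M |A. A \<in> sets borel}" "F s"] measurable_sets[OF X]
    by (auto simp: space_F)
  have sD: "sigma_sets (space M) {?D -` A \<inter> space M |A. A \<in> sets borel} = {?D -` A \<inter> space M |A. A \<in> sets borel}"
    using sets.sigma_sets_eq[of "vimage_algebra (space M) ?D borel"]
    by (simp add: sets_vimage_algebra2 space_vimage_algebra)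
  have ind: "indep_set (sets (F s)) {?D -` A \<inter> space M |A. A \<in> sets borel}"
    using indep_increments[OF assms(1,2)] .
  have "indep_set (sigma_sets (space M) {X -` A \<inter> space M |A. A \<in> sets borel})
      (sigma_sets (space M) {?D -` A \<inter> space M |A. A \<in> sets borel})"
  proof (rule indep_setI)
    show "sigma_sets (space M) {X -` A \<inter> space M |A. A \<in> sets borel} \<subseteq> events"
      using sX sets_F_le[of s] by (rule subset_trans)
    show "sigma_sets (space M) {?D -` A \<inter> space M |A. A \<in> sets borel} \<subseteq> events"
      unfolding sD using meas by (auto intro: measurable_sets)
    fix a b assume "a \<in> sigma_sets (space M) {X -` A \<inter> space M |A. A \<in> sets borel}"
      "b \<in> sigma_sets (space M) {?D -` A \<inter> space M |A. A \<in> sets borel}"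
    then show "prob (a \<inter> b) = prob a * prob b"
      using sX by (intro indep_setD[OF ind]) (auto simp: sD)
  qed
  then show ?thesis using meas by (simp add: indep_var_eq)
qed

lemma indep_var_L_increment:
  assumes "0 \<le> s" "s \<le> t"
  shows "indep_var borel (L s) borel (\<lambda>x. L t x - L s x)"
  using assms by (intro indep_var_increment adapted)

lemma increment_integrable_iff:
  fixes g :: "real \<Rightarrow> 'b::{banach, second_countable_topology}"
  assumes "0 \<le> s" "s \<le> t" and [measurable]: "g \<in> borel_measurable borel"
  shows "integrable M (\<lambda>x. g (L t x - L s x)) \<longleftrightarrow> integrable M (\<lambda>x. g (L (t - s) x))"
  using assms integrable_distr_eq[of "\<lambda>x. L t x - L s x" M borel g] integrable_distr_eq[of "L (t - s)" M borel g]
  by (simp add: stationary_increments)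

lemma increment_integral:
  fixes g :: "real \<Rightarrow> 'b::{banach, second_countable_topology}"
  assumes "0 \<le> s" "s \<le> t" and [measurable]: "g \<in> borel_measurable borel"
  shows "expectation (\<lambda>x. g (L t x - L s x)) = (\<integral>x. g (L (t - s) x) \<partial>M)"
  using assms integral_distr[of "\<lambda>x. L t x - L s x" M borel g] integral_distr[of "L (t - s)" M borel g]
  by (simp add: stationary_increments)

end

context square_integrable_levy_process begin

lemma L_square_integrable:
  assumes "0 \<le> t"
  shows "integrable M (\<lambda>x. (L t x)\<^sup>2)"
proof -
  have base: "integrable M (\<lambda>x. (L t x)\<^sup>2)" if "0 \<le> t" "t \<le> 1" for t
    using indep_summand_square_integrable[OF indep_var_L_increment[OF that]] square_integrable by simp
  have "\<forall>t. 0 \<le> t \<and> t \<le> real n + 1 \<longrightarrow> integrable M (\<lambda>x. (L t x)\<^sup>2)" for n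
  proof (induction n)
    case 0 then show ?case using base by simp
  next
    case (Suc n)
    show ?case
    proof (intro allI impI)
      fix t :: real assume t: "0 \<le> t \<and> t \<le> real (Suc n) + 1"
      show "integrable M (\<lambda>x. (L t x)\<^sup>2)"
      proof (cases "t \<le> 1")
        case False
        have "integrable M (\<lambda>x. (L t x - L (t - 1) x)\<^sup>2)"
          using increment_integrable_iff[of "t - 1" t "\<lambda>y. y\<^sup>2"] False square_integrable by simp
        moreover have "integrable M (\<lambda>x. (L (t - 1) x)\<^sup>2)"
          using Suc t False by simp
        ultimately have "integrable M (\<lambda>x. (L (t - 1) x + (L t x - L (t - 1) x))\<^sup>2)"
          using False by (intro integrable_square_add) auto
        then show ?thesis by simp
      qed (use base t in simp)
    qed
  qed
  moreover obtain n where "t \<le> real n" using real_arch_simple by blast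
  ultimately show ?thesis using assms by (meson add_increasing2 zero_le_one)
qed

lemma L_integrable [simp]: "0 \<le> t \<Longrightarrow> integrable M (L t)"
  by (rule square_integrable_imp_integrable[OF _ L_square_integrable]) auto

lemma mean_add:
  assumes "0 \<le> s" "0 \<le> t"
  shows "expectation (L (s + t)) = expectation (L s) + expectation (L t)"
proof -
  have "expectation (L (s + t)) = expectation (\<lambda>x. L s x + (L (s + t) x - L s x))" by simp
  also have "\<dots> = expectation (L s) + expectation (\<lambda>x. L (s + t) x - L s x)"
    using assms by (intro Bochner_Integration.integral_add) auto
  also have "expectation (\<lambda>x. L (s + t) x - L s x) = expectation (L t)"
    using increment_integral[of s "s + t" "\<lambda>y. y"] assms by simp
  finally show ?thesis .
qed

lemma variance_add:
  assumes "0 \<le> s" "0 \<le> t"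
  shows "variance (L (s + t)) = variance (L s) + variance (L t)"
proof -
  let ?D = "\<lambda>x. L (s + t) x - L s x"
  have ind: "indep_var borel (L s) borel ?D" using indep_var_L_increment assms by simp
  have iD: "integrable M ?D" "integrable M (\<lambda>x. (?D x)\<^sup>2)"
    using assms increment_integrable_iff[of s "s + t" "\<lambda>y. y\<^sup>2"] L_square_integrable by auto
  have eD: "expectation ?D = expectation (L t)" "expectation (\<lambda>x. (?D x)\<^sup>2) = expectation (\<lambda>x. (L t x)\<^sup>2)"
    using increment_integral[of s "s + t" "\<lambda>y. y"] increment_integral[of s "s + t" "\<lambda>y. y\<^sup>2"] assms by simp_all
  have iP: "integrable M (\<lambda>x. L s x * ?D x)"
    using ind assms iD by (intro indep_var_integrable) auto
  have eP: "expectation (\<lambda>x. L s x * ?D x) = expectation (L s) * expectation (L t)"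
    using indep_var_lebesgue_integral[OF ind] assms iD eD by simp
  have "expectation (\<lambda>x. (L (s + t) x)\<^sup>2) = expectation (\<lambda>x. (L s x)\<^sup>2 + ((?D x)\<^sup>2 + 2 * (L s x * ?D x)))"
    by (intro Bochner_Integration.integral_cong refl) (simp add: power2_eq_square algebra_simps)
  also have "\<dots> = expectation (\<lambda>x. (L s x)\<^sup>2) + (expectation (\<lambda>x. (L t x)\<^sup>2) + 2 * (expectation (L s) * expectation (L t)))"
    using assms iD iP L_square_integrable eD eP by simp
  finally have "expectation (\<lambda>x. (L (s + t) x)\<^sup>2) = \<dots>" .
  moreover have v: "variance (L r) = expectation (\<lambda>x. (L r x)\<^sup>2) - (expectation (L r))\<^sup>2" if "0 \<le> r" for r
    using that by (intro variance_eq L_square_integrable) auto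
  ultimately show ?thesis
    unfolding v[OF assms(1)] v[OF assms(2)] v[OF add_nonneg_nonneg[OF assms]]
    using assms by (simp add: mean_add power2_sum)
qed

text \<open>Variances are nonnegative, so the additive function \<open>t \<mapsto> variance (L t)\<close> is monotone.\<close>

lemma variance_bounded:
  assumes "0 \<le> t" "t \<le> 1"
  shows "\<bar>variance (L t)\<bar> \<le> variance (L 1)"
proof -
  have "variance (L 1) = variance (L t) + variance (L (1 - t))"
    using variance_add[of t "1 - t"] assms by simp
  then show ?thesis using variance_positive[of "L t"] variance_positive[of "L (1 - t)"] by linarith
qed

lemma variance_linear: "0 \<le> t \<Longrightarrow> variance (L t) = t * variance (L 1)"
  by (rule additive_bounded_imp_linear[where g = "\<lambda>t. variance (L t)"])
    (use variance_add variance_bounded in auto)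

text \<open>The mean is additive as well, but boundedness near 0 needs an argument: for small \<open>t\<close> the variable
\<open>L t\<close> is close to \<open>L 0 = 0\<close> by stochastic continuity and close to its mean by Chebyshev's
inequality, because its variance is small; so the mean cannot be large. Additivity spreads the bound
from a neighbourhood of 0 to the unit interval.\<close>

lemma mean_bounded: "\<exists>B. \<forall>t. 0 \<le> t \<and> t \<le> 1 \<longrightarrow> \<bar>expectation (L t)\<bar> \<le> B"
proof -
  have "((\<lambda>t. prob {x \<in> space M. dist (L t x) (L 0 x) > 1}) \<longlongrightarrow> 0) (at 0 within {0..})"
    using stochastically_continuous[of 0] by (auto simp: tendsto_in_prob_def)
  then have "\<forall>\<^sub>F t in at 0 within {0..}. prob {x \<in> space M. dist (L t x) (L 0 x) > 1} < 1/2"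
    by (rule order_tendstoD) simp
  then obtain d where d: "d > 0" "\<And>t. 0 < t \<Longrightarrow> t < d \<Longrightarrow> prob {x \<in> space M. dist (L t x) (L 0 x) > 1} < 1/2"
    by (auto simp: eventually_at dist_real_def)
  define v where "v = variance (L 1)"
  \<comment> \<open>The second bound makes the variance, hence the probability in Chebyshevs inequality, less than \<open>1/2\<close>.\<close>
  define e where "e = min d (1 / (2 * (v + 1)))"
  have pos: "v \<ge> 0" unfolding v_def by (rule variance_positive)
  have e: "e > 0" "e \<le> d" using d pos by (auto simp: e_def)
  have small: "\<bar>expectation (L t)\<bar> \<le> 2" if t: "0 < t" "t < e" for t
  proof (rule ccontr)
    assume big: "\<not> \<bar>expectation (L t)\<bar> \<le> 2"
    have [measurable]: "L t \<in> borel_measurable M" "L 0 \<in> borel_measurable M" using t by auto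
    let ?A = "{x \<in> space M. dist (L t x) (L 0 x) > 1}"
    let ?B = "{x \<in> space M. 1 \<le> \<bar>L t x - expectation (L t)\<bar>}"
    have "t * (2 * (v + 1)) < 1"
      using t pos by (simp add: e_def less_divide_eq)
    then have "t * v < 1 / 2" using t by (simp add: algebra_simps)
    then have "prob ?B < 1 / 2"
      using Chebyshev_inequality[of "L t" 1] t L_square_integrable[of t] variance_linear[of t] by (simp add: v_def)
    moreover have "prob ?A < 1 / 2" using d t e by simp
    moreover have "1 = prob (?A \<union> ?B)"
    proof -
      have "AE x in M. x \<in> ?A \<union> ?B"
        using zero AE_space
      proof eventually_elim
        case (elim x)
        then show ?case using big by (auto simp: dist_real_def)
      qed
      then show ?thesis by (subst eq_commute, subst prob_eq_1) auto
    qed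
    moreover have "prob (?A \<union> ?B) \<le> prob ?A + prob ?B" by (rule measure_Un_le) auto
    ultimately show False by simp
  qed
  obtain K :: nat where K: "K > 0" "1 / real K < e"
    using reals_Archimedean[OF \<open>e > 0\<close>] by (auto simp: inverse_eq_divide) (metis zero_less_Suc of_nat_Suc)
  have scale: "expectation (L (real n * t)) = real n * expectation (L t)" if "0 \<le> t" for n t
  proof (induction n)
    case 0
    show ?case using mean_add[of 0 0] by simp
  next
    case (Suc n)
    then show ?case using mean_add[of t "real n * t"] that by (simp add: algebra_simps)
  qed
  have "\<bar>expectation (L t)\<bar> \<le> real K * 2" if t: "0 \<le> t" "t \<le> 1" for t
  proof (cases "t = 0")
    case True
    then show ?thesis using mean_add[of 0 0] by simp
  next
    case False
    have "t / real K \<le> 1 / real K" using t K by (simp add: divide_right_mono)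
    then have "\<bar>expectation (L (t / real K))\<bar> \<le> 2" using K t False by (intro small) auto
    moreover have "expectation (L t) = real K * expectation (L (t / real K))"
      using scale[of "t / real K" K] t K by simp
    ultimately show ?thesis using K by (simp add: abs_mult)
  qed
  then show ?thesis by blast
qed

lemma mean_zero:
  assumes "0 \<le> t"
  shows "expectation (L t) = 0"
proof -
  obtain B where "\<And>t. 0 \<le> t \<Longrightarrow> t \<le> 1 \<Longrightarrow> \<bar>expectation (L t)\<bar> \<le> B" using mean_bounded by blast
  from additive_bounded_imp_linear[of "\<lambda>t. expectation (L t)", OF mean_add this assms] centred
  show ?thesis by simp
qed

lemma second_moment_L: "0 \<le> t \<Longrightarrow> expectation (\<lambda>x. (L t x)\<^sup>2) = \<sigma>\<^sup>2 * t"
  using variance_linear[of t] second_moment by (simp add: mean_zero)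

text \<open>For \<open>s \<le> t\<close> the increment after time \<open>s\<close> is centred and independent of \<open>L s\<close>, which leaves the second
moment at the earlier time.\<close>

lemma covariance:
  assumes "0 \<le> s" "0 \<le> t"
  shows "expectation (\<lambda>x. L s x * L t x) = \<sigma>\<^sup>2 * min s t"
proof -
  have *: "expectation (\<lambda>x. L s x * L t x) = \<sigma>\<^sup>2 * s" if "0 \<le> s" "s \<le> t" for s t
  proof -
    let ?D = "\<lambda>x. L t x - L s x"
    have ind: "indep_var borel (L s) borel ?D" using indep_var_L_increment that by simp
    have iP: "integrable M (\<lambda>x. L s x * ?D x)"
      using ind that by (intro indep_var_integrable) auto
    have eP: "expectation (\<lambda>x. L s x * ?D x) = 0"
      using indep_var_lebesgue_integral[OF ind] that mean_zero[of s] mean_zero[of t] by simp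
    have "expectation (\<lambda>x. L s x * L t x) = expectation (\<lambda>x. (L s x)\<^sup>2 + L s x * ?D x)"
      by (intro Bochner_Integration.integral_cong refl) (simp add: power2_eq_square algebra_simps)
    also have "\<dots> = \<sigma>\<^sup>2 * s"
      using that iP eP by (simp add: L_square_integrable second_moment_L)
    finally show ?thesis .
  qed
  show ?thesis
    using *[of s t] *[of t s] assms by (cases "s \<le> t") (auto simp: mult.commute min_def)
qed

end

section \<open>The isometry and the existence of the integral\<close>

lemma cmod_sum_squared:
  fixes c :: "'i \<Rightarrow> complex" and y :: "'i \<Rightarrow> real"
  shows "(cmod (\<Sum>i\<in>I. c i * complex_of_real (y i)))\<^sup>2 = (\<Sum>i\<in>I. \<Sum>j\<in>I. Re (c i * cnj (c j)) * (y i * y j))"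
proof -
  let ?z = "\<Sum>i\<in>I. c i * complex_of_real (y i)"
  have "complex_of_real ((cmod ?z)\<^sup>2) = ?z * cnj ?z" by (rule complex_norm_square)
  also have "\<dots> = (\<Sum>i\<in>I. \<Sum>j\<in>I. (c i * cnj (c j)) * complex_of_real (y i * y j))"
    by (simp add: sum_product mult_ac)
  finally have "Re (complex_of_real ((cmod ?z)\<^sup>2)) = Re (\<Sum>i\<in>I. \<Sum>j\<in>I. (c i * cnj (c j)) * complex_of_real (y i * y j))"
    by (rule arg_cong)
  moreover have "Re (z * complex_of_real r) = Re z * r" for z r by simp
  ultimately show ?thesis by (simp only: Re_complex_of_real Re_sum)
qed

text \<open>The second moment of a linear combination depends only on the Gram matrix of its terms. This is what
turns the equality of covariances of increments and scalar products of interval indicators into an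
isometry.\<close>

lemma integral_cmod_sum_squared:
  fixes c :: "'i \<Rightarrow> complex" and Y :: "'i \<Rightarrow> 'a \<Rightarrow> real"
  assumes "\<And>i j. i \<in> I \<Longrightarrow> j \<in> I \<Longrightarrow> integrable M (\<lambda>x. Y i x * Y j x)"
  shows "integrable M (\<lambda>x. (cmod (\<Sum>i\<in>I. c i * complex_of_real (Y i x)))\<^sup>2)"
    and "(\<integral>x. (cmod (\<Sum>i\<in>I. c i * complex_of_real (Y i x)))\<^sup>2 \<partial>M)
      = (\<Sum>i\<in>I. \<Sum>j\<in>I. Re (c i * cnj (c j)) * (\<integral>x. Y i x * Y j x \<partial>M))"
proof -
  show "integrable M (\<lambda>x. (cmod (\<Sum>i\<in>I. c i * complex_of_real (Y i x)))\<^sup>2)"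
    unfolding cmod_sum_squared
    by (intro Bochner_Integration.integrable_sum integrable_mult_right assms)
  show "(\<integral>x. (cmod (\<Sum>i\<in>I. c i * complex_of_real (Y i x)))\<^sup>2 \<partial>M)
      = (\<Sum>i\<in>I. \<Sum>j\<in>I. Re (c i * cnj (c j)) * (\<integral>x. Y i x * Y j x \<partial>M))"
    unfolding cmod_sum_squared
    by (subst Bochner_Integration.integral_sum,
        intro Bochner_Integration.integrable_sum integrable_mult_right assms, assumption+,
        intro sum.cong refl, subst Bochner_Integration.integral_sum,
        intro integrable_mult_right assms, assumption+, simp del: times_complex.sel)
qed

lemma integral_diff_mult_diff:
  fixes A B C D :: "'a \<Rightarrow> real"
  assumes "integrable M (\<lambda>x. B x * D x)" "integrable M (\<lambda>x. B x * C x)"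
    "integrable M (\<lambda>x. A x * D x)" "integrable M (\<lambda>x. A x * C x)"
  shows "integrable M (\<lambda>x. (B x - A x) * (D x - C x))"
    and "(\<integral>x. (B x - A x) * (D x - C x) \<partial>M)
      = (\<integral>x. B x * D x \<partial>M) - (\<integral>x. B x * C x \<partial>M) - ((\<integral>x. A x * D x \<partial>M) - (\<integral>x. A x * C x \<partial>M))"
proof -
  have *: "(B x - A x) * (D x - C x) = (B x * D x - B x * C x) - (A x * D x - A x * C x)" for x
    by (simp add: algebra_simps)
  show "integrable M (\<lambda>x. (B x - A x) * (D x - C x))"
    unfolding * by (intro Bochner_Integration.integrable_diff assms)
  show "(\<integral>x. (B x - A x) * (D x - C x) \<partial>M)
      = (\<integral>x. B x * D x \<partial>M) - (\<integral>x. B x * C x \<partial>M) - ((\<integral>x. A x * D x \<partial>M) - (\<integral>x. A x * C x \<partial>M))"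
    unfolding * by (simp add: assms)
qed

lemma integrable_indicator_Ioc_mult:
  fixes a b c d :: real
  shows "integrable lborel (\<lambda>t. indicator {a<..b} t * indicator {c<..d} t :: real)"
proof -
  have "emeasure lborel {x<..y} < \<infinity>" for x y :: real
    by (cases "x \<le> y") simp_all
  then show ?thesis
    unfolding indicator_inter_arith[symmetric] Int_greaterThanAtMost
    by (intro integrable_real_indicator) simp_all
qed

lemma integral_indicator_Ioc_mult:
  "0 \<le> s \<Longrightarrow> 0 \<le> t \<Longrightarrow> (\<integral>u. indicator {0<..s} u * indicator {0<..t} u \<partial>lborel) = min s (t::real)"
  unfolding indicator_inter_arith[symmetric]
  by (simp add: Int_greaterThanAtMost)

context square_integrable_levy_process begin

lemma L_mult_integrable: "0 \<le> s \<Longrightarrow> 0 \<le> t \<Longrightarrow> integrable M (\<lambda>x. L s x * L t x)"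
  by (intro integrable_mult_of_squares L_square_integrable) auto

lemma increment_mult_integrable:
  assumes "0 \<le> a" "0 \<le> b" "0 \<le> c" "0 \<le> d"
  shows "integrable M (\<lambda>x. (L b x - L a x) * (L d x - L c x))"
  using assms by (intro integral_diff_mult_diff(1) L_mult_integrable)

text \<open>Both sides are bilinear in the increments, and on initial intervals both equal the minimum of the
end points, up to the factor \<open>\<sigma>\<^sup>2\<close>.\<close>

lemma increment_covariance:
  assumes "0 \<le> a" "a \<le> b" "0 \<le> c" "c \<le> d"
  shows "expectation (\<lambda>x. (L b x - L a x) * (L d x - L c x))
    = \<sigma>\<^sup>2 * (\<integral>t. indicator {a<..b} t * indicator {c<..d} t \<partial>lborel)"
proof -
  let ?Y = "\<lambda>s t. indicator {0<..s} t :: real"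
  have ind: "indicator {s<..t} u = ?Y t u - ?Y s u" if "0 \<le> s" "s \<le> t" for s t u :: real
    using that by (auto simp: indicator_def)
  have nonneg: "0 \<le> b" "0 \<le> d" using assms by simp_all
  have "expectation (\<lambda>x. (L b x - L a x) * (L d x - L c x))
    = expectation (\<lambda>x. L b x * L d x) - expectation (\<lambda>x. L b x * L c x)
      - (expectation (\<lambda>x. L a x * L d x) - expectation (\<lambda>x. L a x * L c x))"
    by (rule integral_diff_mult_diff(2)) (intro L_mult_integrable assms nonneg)+
  also have "\<dots> = \<sigma>\<^sup>2 * (min b d - min b c - (min a d - min a c))"
    by (simp only: covariance assms nonneg right_diff_distrib)
  also have "min b d - min b c - (min a d - min a c) = (\<integral>t. (?Y b t - ?Y a t) * (?Y d t - ?Y c t) \<partial>lborel)"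
    by (subst integral_diff_mult_diff(2), (rule integrable_indicator_Ioc_mult)+)
      (simp only: integral_indicator_Ioc_mult assms nonneg)
  finally show ?thesis
    unfolding ind[OF assms(1,2)] ind[OF assms(3,4)] .
qed

text \<open>The intervals may overlap, so step functions over different subdivisions can be compared without
passing to a common refinement.\<close>

lemma increment_sum_isometry:
  fixes c :: "'i \<Rightarrow> complex"
  assumes "\<And>i. i \<in> I \<Longrightarrow> 0 \<le> a i \<and> a i \<le> b i"
  shows "integrable M (\<lambda>x. (cmod (\<Sum>i\<in>I. c i * complex_of_real (L (b i) x - L (a i) x)))\<^sup>2)"
    and "integrable lborel (\<lambda>t. (cmod (\<Sum>i\<in>I. c i * complex_of_real (indicator {a i<..b i} t)))\<^sup>2)"
    and "expectation (\<lambda>x. (cmod (\<Sum>i\<in>I. c i * complex_of_real (L (b i) x - L (a i) x)))\<^sup>2)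
      = \<sigma>\<^sup>2 * (\<integral>t. (cmod (\<Sum>i\<in>I. c i * complex_of_real (indicator {a i<..b i} t)))\<^sup>2 \<partial>lborel)"
proof -
  have iL: "integrable M (\<lambda>x. (L (b i) x - L (a i) x) * (L (b j) x - L (a j) x))"
    if "i \<in> I" "j \<in> I" for i j
    using assms[OF that(1)] assms[OF that(2)] by (intro increment_mult_integrable) auto
  show "integrable M (\<lambda>x. (cmod (\<Sum>i\<in>I. c i * complex_of_real (L (b i) x - L (a i) x)))\<^sup>2)"
    by (rule integral_cmod_sum_squared(1)) (rule iL)
  show "integrable lborel (\<lambda>t. (cmod (\<Sum>i\<in>I. c i * complex_of_real (indicator {a i<..b i} t)))\<^sup>2)"
    by (rule integral_cmod_sum_squared(1)) (rule integrable_indicator_Ioc_mult)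
  have "expectation (\<lambda>x. (cmod (\<Sum>i\<in>I. c i * complex_of_real (L (b i) x - L (a i) x)))\<^sup>2)
    = (\<Sum>i\<in>I. \<Sum>j\<in>I. Re (c i * cnj (c j)) * expectation (\<lambda>x. (L (b i) x - L (a i) x) * (L (b j) x - L (a j) x)))"
    by (rule integral_cmod_sum_squared(2)) (rule iL)
  also have "\<dots> = (\<Sum>i\<in>I. \<Sum>j\<in>I. \<sigma>\<^sup>2 * (Re (c i * cnj (c j)) * (\<integral>t. indicator {a i<..b i} t * indicator {a j<..b j} t \<partial>lborel)))"
    using assms by (intro sum.cong refl) (simp add: increment_covariance)
  also have "\<dots> = \<sigma>\<^sup>2 * (\<integral>t. (cmod (\<Sum>i\<in>I. c i * complex_of_real (indicator {a i<..b i} t)))\<^sup>2 \<partial>lborel)"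
    by (subst integral_cmod_sum_squared(2)) (simp_all add: integrable_indicator_Ioc_mult sum_distrib_left del: times_complex.sel)
  finally show "expectation (\<lambda>x. (cmod (\<Sum>i\<in>I. c i * complex_of_real (L (b i) x - L (a i) x)))\<^sup>2)
      = \<sigma>\<^sup>2 * (\<integral>t. (cmod (\<Sum>i\<in>I. c i * complex_of_real (indicator {a i<..b i} t)))\<^sup>2 \<partial>lborel)" .
qed

end

lemma subdivision_mono:
  assumes "subdivision T n \<tau>" "i \<le> j" "j \<le> n"
  shows "\<tau> i \<le> \<tau> j"
  using assms(2,3)
proof (induction rule: dec_induct)
  case (step m)
  then show ?case using assms(1) by (auto simp: subdivision_def intro: order_trans)
qed simp

lemma subdivision_nonneg: "subdivision T n \<tau> \<Longrightarrow> i \<le> n \<Longrightarrow> 0 \<le> \<tau> i"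
  using subdivision_mono[of T n \<tau> 0 i] by (simp add: subdivision_def)

lemma subdivision_le: "subdivision T n \<tau> \<Longrightarrow> i \<le> n \<Longrightarrow> \<tau> i \<le> T"
  using subdivision_mono[of T n \<tau> i n] by (simp add: subdivision_def)

lemma step_fun_outside:
  assumes "subdivision T n \<tau>" "t \<notin> {0<..T}"
  shows "step_fun n \<tau> c t = 0"
  unfolding step_fun_def
proof (rule sum.neutral, rule ballI)
  fix i assume "i \<in> {..<n}"
  then have "0 \<le> \<tau> i" "\<tau> (Suc i) \<le> T"
    using subdivision_nonneg[OF assms(1)] subdivision_le[OF assms(1)] by auto
  then have "t \<notin> {\<tau> i<..\<tau> (Suc i)}" using assms(2) by auto
  then show "c i * indicator {\<tau> i<..\<tau> (Suc i)} t = 0" by simp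
qed

context square_integrable_levy_process begin

text \<open>The difference of two step integrals is one sum over the disjoint union of the two index sets.\<close>

lemma step_integral_diff_isometry:
  assumes \<tau>: "subdivision T n \<tau>" and \<tau>': "subdivision T' n' \<tau>'"
  shows "integrable M (\<lambda>x. (cmod (\<alpha> * step_integral L n \<tau> c x - \<beta> * step_integral L n' \<tau>' c' x))\<^sup>2)"
    and "integrable lborel (\<lambda>t. (cmod (\<alpha> * step_fun n \<tau> c t - \<beta> * step_fun n' \<tau>' c' t))\<^sup>2)"
    and "expectation (\<lambda>x. (cmod (\<alpha> * step_integral L n \<tau> c x - \<beta> * step_integral L n' \<tau>' c' x))\<^sup>2)
      = \<sigma>\<^sup>2 * (\<integral>t. (cmod (\<alpha> * step_fun n \<tau> c t - \<beta> * step_fun n' \<tau>' c' t))\<^sup>2 \<partial>lborel)"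
proof -
  let ?I = "{..<n} <+> {..<n'}"
  let ?a = "case_sum \<tau> \<tau>'" and ?b = "case_sum (\<lambda>i. \<tau> (Suc i)) (\<lambda>i. \<tau>' (Suc i))"
  let ?c = "case_sum (\<lambda>i. \<alpha> * c i) (\<lambda>i. - \<beta> * c' i)"
  have le: "0 \<le> ?a i \<and> ?a i \<le> ?b i" if "i \<in> ?I" for i
    using that subdivision_nonneg[OF \<tau>] subdivision_nonneg[OF \<tau>'] \<tau> \<tau>' by (auto simp: subdivision_def)
  have 1: "\<alpha> * step_integral L n \<tau> c x - \<beta> * step_integral L n' \<tau>' c' x
    = (\<Sum>i\<in>?I. ?c i * complex_of_real (L (?b i) x - L (?a i) x))" for x
    by (simp add: step_integral_def sum.Plus sum_distrib_left sum_negf mult.assoc)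
  have 2: "\<alpha> * step_fun n \<tau> c t - \<beta> * step_fun n' \<tau>' c' t
    = (\<Sum>i\<in>?I. ?c i * complex_of_real (indicator {?a i<..?b i} t))" for t
  proof -
    have "indicator A t = complex_of_real (indicator A t)" for A by (simp add: indicator_def)
    then show ?thesis
      by (simp add: step_fun_def sum.Plus sum_distrib_left sum_negf mult.assoc)
  qed
  note iso = increment_sum_isometry[where I = ?I and a = ?a and b = ?b and c = ?c, OF le]
  show "integrable M (\<lambda>x. (cmod (\<alpha> * step_integral L n \<tau> c x - \<beta> * step_integral L n' \<tau>' c' x))\<^sup>2)"
    unfolding 1 by (rule iso(1))
  show "integrable lborel (\<lambda>t. (cmod (\<alpha> * step_fun n \<tau> c t - \<beta> * step_fun n' \<tau>' c' t))\<^sup>2)"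
    unfolding 2 by (rule iso(2))
  show "expectation (\<lambda>x. (cmod (\<alpha> * step_integral L n \<tau> c x - \<beta> * step_integral L n' \<tau>' c' x))\<^sup>2)
      = \<sigma>\<^sup>2 * (\<integral>t. (cmod (\<alpha> * step_fun n \<tau> c t - \<beta> * step_fun n' \<tau>' c' t))\<^sup>2 \<partial>lborel)"
    unfolding 1 2 by (rule iso(3))
qed

lemma step_integral_measurable:
  "subdivision T n \<tau> \<Longrightarrow> step_integral L n \<tau> c \<in> borel_measurable M"
  unfolding step_integral_def using subdivision_nonneg[of T n \<tau>] by measurable

end

text \<open>The variance of the norm is nonnegative.\<close>

lemma (in prob_space) expectation_norm_le_sqrt:
  fixes X :: "'a \<Rightarrow> 'b::{banach, second_countable_topology}"
  assumes [measurable]: "X \<in> borel_measurable M" and int: "integrable M (\<lambda>x. (norm (X x))\<^sup>2)"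
  shows "integrable M (\<lambda>x. norm (X x))"
    and "expectation (\<lambda>x. norm (X x)) \<le> sqrt (expectation (\<lambda>x. (norm (X x))\<^sup>2))"
proof -
  show i: "integrable M (\<lambda>x. norm (X x))"
    by (rule square_integrable_imp_integrable) (use int in auto)
  have "(expectation (\<lambda>x. norm (X x)))\<^sup>2 \<le> expectation (\<lambda>x. (norm (X x))\<^sup>2)"
    using variance_positive[of "\<lambda>x. norm (X x)"] variance_eq[OF i int] by linarith
  then show "expectation (\<lambda>x. norm (X x)) \<le> sqrt (expectation (\<lambda>x. (norm (X x))\<^sup>2))"
    by (rule real_le_rsqrt)
qed

context square_integrable_levy_process begin

lemma step_integral_L1_dist_le:
  assumes \<tau>: "subdivision T n \<tau>" and \<tau>': "subdivision T n' \<tau>'" and "0 \<le> T"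
    and close: "\<And>t. t \<in> {0<..T} \<Longrightarrow> cmod (step_fun n \<tau> c t - step_fun n' \<tau>' c' t) \<le> \<delta>" and "0 \<le> \<delta>"
  shows "integrable M (\<lambda>x. cmod (step_integral L n \<tau> c x - step_integral L n' \<tau>' c' x))"
    and "expectation (\<lambda>x. cmod (step_integral L n \<tau> c x - step_integral L n' \<tau>' c' x)) \<le> \<bar>\<sigma>\<bar> * sqrt T * \<delta>"
proof -
  note [measurable] = step_integral_measurable[OF \<tau>] step_integral_measurable[OF \<tau>']
  note iso = step_integral_diff_isometry[OF \<tau> \<tau>', where \<alpha> = 1 and \<beta> = 1, simplified]
  show "integrable M (\<lambda>x. cmod (step_integral L n \<tau> c x - step_integral L n' \<tau>' c' x))"
    by (rule expectation_norm_le_sqrt(1)) (use iso in auto)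
  have "(\<integral>t. (cmod (step_fun n \<tau> c t - step_fun n' \<tau>' c' t))\<^sup>2 \<partial>lborel) \<le> (\<integral>t. \<delta>\<^sup>2 * indicator {0<..T} t \<partial>lborel)"
  proof (rule integral_mono)
    show "integrable lborel (\<lambda>t. (cmod (step_fun n \<tau> c t - step_fun n' \<tau>' c' t))\<^sup>2)" by (rule iso(2))
    show "integrable lborel (\<lambda>t. \<delta>\<^sup>2 * indicator {0<..T} t)"
      using \<open>0 \<le> T\<close> by (intro integrable_mult_right integrable_real_indicator) auto
    show "(cmod (step_fun n \<tau> c t - step_fun n' \<tau>' c' t))\<^sup>2 \<le> \<delta>\<^sup>2 * indicator {0<..T} t" for t
      using close[of t] step_fun_outside[OF \<tau>, of t] step_fun_outside[OF \<tau>', of t]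
      by (cases "t \<in> {0<..T}") (auto intro: power_mono)
  qed
  also have "\<dots> = \<delta>\<^sup>2 * T" using \<open>0 \<le> T\<close> by simp
  finally have "expectation (\<lambda>x. (cmod (step_integral L n \<tau> c x - step_integral L n' \<tau>' c' x))\<^sup>2) \<le> \<sigma>\<^sup>2 * (\<delta>\<^sup>2 * T)"
    unfolding iso(3) by (rule mult_left_mono) simp
  then have "sqrt (expectation (\<lambda>x. (cmod (step_integral L n \<tau> c x - step_integral L n' \<tau>' c' x))\<^sup>2)) \<le> sqrt (\<sigma>\<^sup>2 * (\<delta>\<^sup>2 * T))"
    by (rule real_sqrt_le_mono)
  also have "\<dots> = \<bar>\<sigma>\<bar> * sqrt T * \<delta>" using \<open>0 \<le> \<delta>\<close> by (simp add: real_sqrt_mult)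
  finally have "sqrt (expectation (\<lambda>x. (cmod (step_integral L n \<tau> c x - step_integral L n' \<tau>' c' x))\<^sup>2))
    \<le> \<bar>\<sigma>\<bar> * sqrt T * \<delta>" .
  from order_trans[OF expectation_norm_le_sqrt(2)[OF _ iso(1)] this]
  show "expectation (\<lambda>x. cmod (step_integral L n \<tau> c x - step_integral L n' \<tau>' c' x)) \<le> \<bar>\<sigma>\<bar> * sqrt T * \<delta>"
    by simp
qed

end

text \<open>Completeness of \<open>L\<^sup>1\<close> in a quantitative form: the series of the norms of the increments has a finite
integral, so it converges almost everywhere, and its tails bound the distance from the limit.\<close>

lemma L1_limit_of_geometric_increments:
  fixes S :: "nat \<Rightarrow> 'a \<Rightarrow> 'b::{banach, second_countable_topology}"
  assumes [measurable]: "\<And>k. S k \<in> borel_measurable M"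
    and int: "\<And>k. integrable M (\<lambda>x. norm (S (Suc k) x - S k x))"
    and le: "\<And>k. (\<integral>x. norm (S (Suc k) x - S k x) \<partial>M) \<le> B * (1/2) ^ k"
  obtains I where "I \<in> borel_measurable M"
    "\<And>m. (\<integral>\<^sup>+x. norm (S m x - I x) \<partial>M) \<le> ennreal (2 * B * (1/2) ^ m)"
proof -
  define D where "D k x = S (Suc k) x - S k x" for k x
  define I where "I x = S 0 x + (\<Sum>k. D k x)" for x
  have [measurable]: "D k \<in> borel_measurable M" for k unfolding D_def by measurable
  have B: "0 \<le> B" using order_trans[OF integral_nonneg_AE le[of 0]] by simp
  \<comment> \<open>The factor 2 is the sum of the geometric series with ratio \<open>1/2\<close>.\<close>
  have tail: "(\<integral>\<^sup>+x. (\<Sum>k. ennreal (norm (D (k + m) x))) \<partial>M) \<le> ennreal (2 * B * (1/2) ^ m)" for m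
  proof -
    have "(\<integral>\<^sup>+x. (\<Sum>k. ennreal (norm (D (k + m) x))) \<partial>M) = (\<Sum>k. \<integral>\<^sup>+x. ennreal (norm (D (k + m) x)) \<partial>M)"
      by (rule nn_integral_suminf) simp
    also have "\<dots> \<le> (\<Sum>k. ennreal (B * (1/2) ^ (k + m)))"
      using int le by (intro suminf_le) (auto simp: D_def nn_integral_eq_integral intro!: ennreal_leI)
    also have "\<dots> = ennreal (2 * B * (1/2) ^ m)"
    proof (rule suminf_ennreal_eq)
      show "(\<lambda>k. B * (1/2) ^ (k + m)) sums (2 * B * (1/2) ^ m)"
        using sums_mult[OF geometric_sums[of "1/2 :: real"], of "B * (1/2) ^ m"]
        by (simp add: power_add mult_ac)
    qed (use B in simp)
    finally show ?thesis .
  qed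
  have "(\<integral>\<^sup>+x. (\<Sum>k. ennreal (norm (D k x))) \<partial>M) < \<infinity>"
    using order.strict_trans1[OF tail[of 0]] by simp
  then have "AE x in M. (\<Sum>k. ennreal (norm (D k x))) \<noteq> \<infinity>"
    by (intro nn_integral_PInf_AE) auto
  then have summable: "AE x in M. summable (\<lambda>k. norm (D k x))"
    by eventually_elim (auto intro: summable_suminf_not_top)
  have "(\<integral>\<^sup>+x. norm (S m x - I x) \<partial>M) \<le> ennreal (2 * B * (1/2) ^ m)" for m
  proof (rule order_trans[OF nn_integral_mono_AE tail])
    show "AE x in M. ennreal (norm (S m x - I x)) \<le> (\<Sum>k. ennreal (norm (D (k + m) x)))"
      using summable
    proof eventually_elim
      case (elim x)
      then have s: "summable (\<lambda>k. D k x)" by (rule summable_norm_cancel)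
      have sm: "summable (\<lambda>k. norm (D (k + m) x))" using elim by (subst summable_iff_shift)
      have "(\<Sum>k<m. D k x) = S m x - S 0 x" unfolding D_def by (rule sum_lessThan_telescope)
      then have "S m x - I x = - (\<Sum>k. D (k + m) x)"
        using suminf_split_initial_segment[OF s, of m] by (simp add: I_def)
      then have "norm (S m x - I x) \<le> (\<Sum>k. norm (D (k + m) x))"
        using summable_norm[OF sm] by simp
      then show ?case using sm by (simp add: suminf_ennreal2 ennreal_leI)
    qed
  qed
  moreover have "I \<in> borel_measurable M" unfolding I_def by measurable
  ultimately show ?thesis by (rule that[rotated])
qed

text \<open>Markov's inequality.\<close>

lemma (in finite_measure) tendsto_in_prob_of_L1:
  fixes X :: "nat \<Rightarrow> 'a \<Rightarrow> 'b::{real_normed_vector, second_countable_topology}"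
  assumes [measurable]: "\<And>k. X k \<in> borel_measurable M" "Y \<in> borel_measurable M"
    and L1: "\<And>e. e > 0 \<Longrightarrow> \<forall>\<^sub>F k in sequentially. (\<integral>\<^sup>+x. norm (X k x - Y x) \<partial>M) \<le> ennreal e"
  shows "tendsto_in_prob M X Y sequentially"
  unfolding tendsto_in_prob_def
proof (intro allI impI)
  fix \<epsilon> :: real assume "\<epsilon> > 0"
  show "(\<lambda>k. measure M {x \<in> space M. dist (X k x) (Y x) > \<epsilon>}) \<longlonglongrightarrow> 0"
  proof (rule order_tendstoI)
    fix \<eta> :: real assume "\<eta> > 0"
    then have "\<epsilon> * \<eta> / 2 > 0" using \<open>\<epsilon> > 0\<close> by simp
    from L1[OF this] show "\<forall>\<^sub>F k in sequentially. measure M {x \<in> space M. dist (X k x) (Y x) > \<epsilon>} < \<eta>"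
    proof eventually_elim
      case (elim k)
      have "emeasure M {x \<in> space M. dist (X k x) (Y x) > \<epsilon>}
        \<le> emeasure M {x \<in> space M. 1 \<le> ennreal (1 / \<epsilon>) * ennreal (norm (X k x - Y x))}"
      proof (intro emeasure_mono subsetI)
        fix x assume "x \<in> {x \<in> space M. dist (X k x) (Y x) > \<epsilon>}"
        then have "x \<in> space M" "1 \<le> 1 / \<epsilon> * norm (X k x - Y x)"
          using \<open>\<epsilon> > 0\<close> by (auto simp: dist_norm)
        have "1 \<le> ennreal (1 / \<epsilon> * norm (X k x - Y x))"
          using ennreal_leI[OF \<open>1 \<le> 1 / \<epsilon> * norm (X k x - Y x)\<close>] by simp
        also have "\<dots> = ennreal (1 / \<epsilon>) * ennreal (norm (X k x - Y x))"
          using \<open>\<epsilon> > 0\<close> by (intro ennreal_mult) auto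
        finally show "x \<in> {x \<in> space M. 1 \<le> ennreal (1 / \<epsilon>) * ennreal (norm (X k x - Y x))}"
          using \<open>x \<in> space M\<close> by simp
      qed measurable
      also have "\<dots> \<le> ennreal (1 / \<epsilon>) * (\<integral>\<^sup>+x. ennreal (norm (X k x - Y x)) * indicator (space M) x \<partial>M)"
        by (rule nn_integral_Markov_inequality) auto
      also have "(\<integral>\<^sup>+x. ennreal (norm (X k x - Y x)) * indicator (space M) x \<partial>M) = (\<integral>\<^sup>+x. ennreal (norm (X k x - Y x)) \<partial>M)"
        by (intro nn_integral_cong) simp
      also have "ennreal (1 / \<epsilon>) * \<dots> \<le> ennreal (1 / \<epsilon>) * ennreal (\<epsilon> * \<eta> / 2)"
        by (rule mult_left_mono[OF elim]) simp
      also have "\<dots> = ennreal (\<eta> / 2)"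
        using \<open>\<epsilon> > 0\<close> \<open>\<eta> > 0\<close> by (simp add: ennreal_mult[symmetric])
      finally have "measure M {x \<in> space M. dist (X k x) (Y x) > \<epsilon>} \<le> \<eta> / 2"
        using \<open>\<eta> > 0\<close> by (simp add: emeasure_eq_measure)
      then show ?case using \<open>\<eta> > 0\<close> by simp
    qed
  qed (simp add: order.strict_trans2)
qed

context square_integrable_levy_process begin

text \<open>By the isometry, uniformly close step functions have step integrals that are close in \<open>L\<^sup>1\<close>. A rapidly
convergent subsequence of the given step functions yields a limit, and every other uniformly
convergent sequence of step functions leads to the same limit.\<close>

lemma ex_is_levy_integral:
  assumes "0 \<le> T" and sub: "\<And>k::nat. subdivision T (n k) (\<tau> k)"
    and unif: "uniform_limit {0<..T} (\<lambda>k. step_fun (n k) (\<tau> k) (c k)) f sequentially"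
  shows "\<exists>I. is_levy_integral M L f T I"
proof -
  have "\<exists>r. \<forall>t\<in>{0<..T}. cmod (step_fun (n r) (\<tau> r) (c r) t - f t) \<le> (1/2) ^ k" for k :: nat
  proof -
    have "\<forall>\<^sub>F r in sequentially. \<forall>t\<in>{0<..T}. dist (step_fun (n r) (\<tau> r) (c r) t) (f t) < (1/2) ^ k"
      using unif by (rule uniform_limitD) simp
    then obtain r where "\<forall>t\<in>{0<..T}. dist (step_fun (n r) (\<tau> r) (c r) t) (f t) < (1/2) ^ k"
      by (auto simp: eventually_sequentially)
    then show ?thesis by (auto simp: dist_norm intro!: exI[of _ r] less_imp_le)
  qed
  then obtain r where r: "\<And>k t. t \<in> {0<..T} \<Longrightarrow> cmod (step_fun (n (r k)) (\<tau> (r k)) (c (r k)) t - f t) \<le> (1/2) ^ k"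
    by metis
  define \<phi> where "\<phi> k = step_fun (n (r k)) (\<tau> (r k)) (c (r k))" for k
  define S where "S k = step_integral L (n (r k)) (\<tau> (r k)) (c (r k))" for k
  define K where "K = \<bar>\<sigma>\<bar> * sqrt T"
  have K: "K \<ge> 0" using \<open>0 \<le> T\<close> by (simp add: K_def)
  have S_meas: "S k \<in> borel_measurable M" for k
    unfolding S_def by (rule step_integral_measurable[OF sub])
  have dist: "integrable M (\<lambda>x. cmod (step_integral L n' \<tau>' c' x - S k x)) \<and>
      expectation (\<lambda>x. cmod (step_integral L n' \<tau>' c' x - S k x)) \<le> K * (\<delta> + (1/2) ^ k)"
    if "subdivision T n' \<tau>'" "\<And>t. t \<in> {0<..T} \<Longrightarrow> cmod (step_fun n' \<tau>' c' t - f t) \<le> \<delta>" "0 \<le> \<delta>"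
    for n' \<tau>' c' \<delta> k
  proof -
    have "cmod (step_fun n' \<tau>' c' t - step_fun (n (r k)) (\<tau> (r k)) (c (r k)) t) \<le> \<delta> + (1/2) ^ k"
      if "t \<in> {0<..T}" for t
      using norm_triangle_ineq4[of "step_fun n' \<tau>' c' t - f t" "step_fun (n (r k)) (\<tau> (r k)) (c (r k)) t - f t"]
        that(1) \<open>t \<in> {0<..T} \<Longrightarrow> cmod (step_fun n' \<tau>' c' t - f t) \<le> \<delta>\<close> r[of t k]
      by simp
    from step_integral_L1_dist_le[OF that(1) sub \<open>0 \<le> T\<close> this] that(3)
    show ?thesis unfolding S_def K_def by simp
  qed
  have step: "integrable M (\<lambda>x. cmod (S (Suc k) x - S k x))"
    "expectation (\<lambda>x. cmod (S (Suc k) x - S k x)) \<le> (2 * K) * (1/2) ^ k" for k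
  proof -
    have "integrable M (\<lambda>x. cmod (S (Suc k) x - S k x)) \<and>
      expectation (\<lambda>x. cmod (S (Suc k) x - S k x)) \<le> K * ((1/2) ^ Suc k + (1/2) ^ k)"
      unfolding S_def[of "Suc k"] by (rule dist[OF sub r]) auto
    moreover have "K * ((1/2) ^ Suc k + (1/2) ^ k) \<le> K * (2 * (1/2) ^ k)"
      using K by (intro mult_left_mono) auto
    ultimately show "integrable M (\<lambda>x. cmod (S (Suc k) x - S k x))"
      "expectation (\<lambda>x. cmod (S (Suc k) x - S k x)) \<le> (2 * K) * (1/2) ^ k" by auto
  qed
  obtain I where I [measurable]: "I \<in> borel_measurable M"
    and I_le: "\<And>m. (\<integral>\<^sup>+x. norm (S m x - I x) \<partial>M) \<le> ennreal (2 * (2 * K) * (1/2) ^ m)"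
    by (rule L1_limit_of_geometric_increments[OF S_meas step]) blast
  have "is_levy_integral M L f T I"
    unfolding is_levy_integral_def
  proof (intro conjI allI impI)
    show "I \<in> borel_measurable M" by fact
    fix n' \<tau>' c' assume sub': "\<forall>k::nat. subdivision T (n' k) (\<tau>' k)"
      and unif': "uniform_limit {0<..T} (\<lambda>k. step_fun (n' k) (\<tau>' k) (c' k)) f sequentially"
    let ?S = "\<lambda>k. step_integral L (n' k) (\<tau>' k) (c' k)"
    have [measurable]: "?S k \<in> borel_measurable M" for k
      by (rule step_integral_measurable[OF sub'[rule_format]])
    show "tendsto_in_prob M ?S I sequentially"
    proof (rule tendsto_in_prob_of_L1)
      fix e :: real assume "e > 0"
      \<comment> \<open>The factor 5 is the sum of the contributions of \<open>dist\<close> and of \<open>I_le\<close>.\<close>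
      have "(\<lambda>m. 5 * K * (1/2) ^ m) \<longlonglongrightarrow> 5 * K * 0"
        by (intro tendsto_intros LIMSEQ_power_zero) simp
      then have "\<forall>\<^sub>F m in sequentially. 5 * K * (1/2) ^ m < e / 2"
        using \<open>e > 0\<close> by (intro order_tendstoD) auto
      then obtain m where m: "5 * K * (1/2) ^ m < e / 2" by (auto simp: eventually_sequentially)
      \<comment> \<open>Adding 1 avoids a division by zero for \<open>K = 0\<close>.\<close>
      define \<delta> where "\<delta> = e / (2 * (K + 1))"
      have "\<delta> > 0" using \<open>e > 0\<close> K by (simp add: \<delta>_def)
      have "K * \<delta> \<le> (K + 1) * \<delta>" using \<open>\<delta> > 0\<close> by (intro mult_right_mono) auto
      also have "\<dots> = e / 2" using K by (simp add: \<delta>_def divide_simps)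
      finally have \<delta>: "K * \<delta> \<le> e / 2" .
      have "\<forall>\<^sub>F k in sequentially. \<forall>t\<in>{0<..T}. dist (step_fun (n' k) (\<tau>' k) (c' k) t) (f t) < \<delta>"
        using unif' \<open>\<delta> > 0\<close> by (rule uniform_limitD)
      then show "\<forall>\<^sub>F k in sequentially. (\<integral>\<^sup>+x. norm (?S k x - I x) \<partial>M) \<le> ennreal e"
      proof eventually_elim
        case (elim k)
        have d: "integrable M (\<lambda>x. cmod (?S k x - S m x))" "expectation (\<lambda>x. cmod (?S k x - S m x)) \<le> K * (\<delta> + (1/2) ^ m)"
          using dist[OF sub'[rule_format], of k "c' k" \<delta> m] elim \<open>\<delta> > 0\<close> by (auto simp: dist_norm less_imp_le)
        note [measurable] = S_meas
        have "(\<integral>\<^sup>+x. norm (?S k x - I x) \<partial>M) \<le> (\<integral>\<^sup>+x. ennreal (norm (?S k x - S m x)) + ennreal (norm (S m x - I x)) \<partial>M)"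
        proof (rule nn_integral_mono)
          fix x
          have "norm (?S k x - I x) \<le> norm (?S k x - S m x) + norm (S m x - I x)"
            using norm_triangle_ineq[of "?S k x - S m x" "S m x - I x"] by simp
          then show "ennreal (norm (?S k x - I x)) \<le> ennreal (norm (?S k x - S m x)) + ennreal (norm (S m x - I x))"
            by (simp add: ennreal_leI flip: ennreal_plus)
        qed
        also have "\<dots> = (\<integral>\<^sup>+x. ennreal (norm (?S k x - S m x)) \<partial>M) + (\<integral>\<^sup>+x. ennreal (norm (S m x - I x)) \<partial>M)"
          by (rule nn_integral_add) auto
        also have "\<dots> \<le> ennreal (K * (\<delta> + (1/2) ^ m)) + ennreal (2 * (2 * K) * (1/2) ^ m)"
          using d by (intro add_mono I_le) (simp add: nn_integral_eq_integral ennreal_leI)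
        also have "\<dots> = ennreal (K * \<delta> + 5 * K * (1/2) ^ m)"
          using K \<open>\<delta> > 0\<close> by (subst ennreal_plus[symmetric]) (auto simp: algebra_simps)
        also have "\<dots> \<le> ennreal e" using \<delta> m by (intro ennreal_leI) simp
        finally show ?case .
      qed
    qed simp_all
  qed
  then show ?thesis by blast
qed

end

section \<open>Characteristic functions of sums of independent increments\<close>

lemma step_fun_inside:
  assumes \<tau>: "subdivision T n \<tau>" and t: "0 < t" "t \<le> T"
  obtains i where "i < n" "\<tau> i < t" "t \<le> \<tau> (Suc i)" "step_fun n \<tau> c t = c i"
proof -
  have "n \<noteq> 0" using \<tau> t by (cases n) (auto simp: subdivision_def)
  then have ex: "t \<le> \<tau> (Suc (n - 1))" using \<tau> t by (simp add: subdivision_def)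
  define i where "i = (LEAST i. t \<le> \<tau> (Suc i))"
  have i: "t \<le> \<tau> (Suc i)" "i \<le> n - 1"
    unfolding i_def using ex by (rule LeastI, intro Least_le)
  have "i < n" using i(2) \<open>n \<noteq> 0\<close> by simp
  have "\<tau> i < t"
  proof (cases i)
    case 0
    then show ?thesis using \<tau> t by (simp add: subdivision_def)
  next
    case (Suc k)
    then show ?thesis using not_less_Least[of k "\<lambda>i. t \<le> \<tau> (Suc i)"] by (simp add: i_def)
  qed
  have other: "t \<notin> {\<tau> j<..\<tau> (Suc j)}" if "j < n" "j \<noteq> i" for j
  proof (cases "j < i")
    case True
    then have "\<tau> (Suc j) \<le> \<tau> i" using \<open>i < n\<close> by (intro subdivision_mono[OF \<tau>]) auto
    then show ?thesis using \<open>\<tau> i < t\<close> by auto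
  next
    case False
    then have "\<tau> (Suc i) \<le> \<tau> j" using that by (intro subdivision_mono[OF \<tau>]) auto
    then show ?thesis using i by auto
  qed
  have "step_fun n \<tau> c t = (\<Sum>j<n. if j = i then c i else 0)"
    unfolding step_fun_def using other i \<open>\<tau> i < t\<close> by (intro sum.cong refl) (auto simp: indicator_def)
  then have "step_fun n \<tau> c t = c i" using \<open>i < n\<close> by simp
  with \<open>i < n\<close> \<open>\<tau> i < t\<close> i(1) show ?thesis by (rule that)
qed

lemma char_eq_cis: "X \<in> borel_measurable M \<Longrightarrow> char (distr M borel X) t = (\<integral>x. cis (t * X x) \<partial>M)"
  by (simp add: char_def integral_distr cis_conv_exp)

text \<open>By induction on the number of increments: the partial sum is known at time \<open>n h\<close>, hence independent
of the next increment, which has the law of \<open>L h\<close> by stationarity.\<close>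

lemma (in levy_process) char_weighted_increments:
  assumes "0 \<le> h"
  shows "(\<integral>x. cis (\<Sum>j<n. g j * (L (real (Suc j) * h) x - L (real j * h) x)) \<partial>M)
    = (\<Prod>j<n. char (distr M borel (L h)) (g j))"
proof -
  define D where "D j x = L (real (Suc j) * h) x - L (real j * h) x" for j x
  define S where "S n x = (\<Sum>j<n. g j * D j x)" for n x
  have times: "0 \<le> real j * h" "real j * h \<le> real (Suc j) * h" for j
    using assms by (simp_all add: mult_right_mono)
  have S_F: "S n \<in> borel_measurable (F (real n * h))" for n
  proof -
    have meas: "L (real j * h) \<in> borel_measurable (F (real n * h))" if "j \<le> n" for j
      by (rule F_measurable_mono[OF _ adapted]) (use that assms in \<open>auto intro: mult_right_mono\<close>)
    have "D j \<in> borel_measurable (F (real n * h))" if "j < n" for j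
      unfolding D_def by (intro borel_measurable_diff meas) (use that in auto)
    then show ?thesis
      unfolding S_def by (intro borel_measurable_sum borel_measurable_times) auto
  qed
  have "char (distr M borel (S n)) 1 = (\<Prod>j<n. char (distr M borel (L h)) (g j))"
  proof (induction n)
    case 0
    then show ?case using char_eq_cis[of "\<lambda>_. 0" M 1] by (simp add: S_def prob_space)
  next
    case (Suc n)
    have "indep_var borel (S n) borel (D n)"
      unfolding D_def by (intro indep_var_increment times S_F)
    then have "indep_var borel ((\<lambda>y. y) \<circ> S n) borel ((\<lambda>y. g n * y) \<circ> D n)"
      by (rule indep_var_compose) auto
    then have "char (distr M borel (\<lambda>x. S n x + g n * D n x)) 1
      = char (distr M borel (S n)) 1 * char (distr M borel (\<lambda>x. g n * D n x)) 1"
      using char_distr_add[of "(\<lambda>y. y) \<circ> S n" "(\<lambda>y. g n * y) \<circ> D n" 1] by (simp add: comp_def)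
    also have "char (distr M borel (\<lambda>x. g n * D n x)) 1 = char (distr M borel (D n)) (g n)"
    proof -
      have "D n \<in> borel_measurable M" unfolding D_def using times by measurable
      then show ?thesis by (simp add: char_eq_cis)
    qed
    also have "distr M borel (D n) = distr M borel (L h)"
      unfolding D_def using stationary_increments[OF times, of n] by (simp add: algebra_simps)
    also have "(\<lambda>x. S n x + g n * D n x) = S (Suc n)" by (simp add: S_def fun_eq_iff)
    finally show ?case using Suc by simp
  qed
  then show ?thesis
    using F_measurable_imp[OF S_F] by (simp add: char_eq_cis) (simp add: S_def D_def)
qed

text \<open>The analytic core of the central limit theorem for identically distributed summands, including the
degenerate case \<open>v = 0\<close>. The second order Taylor estimate of the characteristic function compares its
\<open>N\<close>-th power with \<open>(1 - v t\<^sup>2 / (2 N))\<^sup>N\<close>.\<close>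

lemma (in real_distribution) char_power_tendsto:
  assumes int1: "integrable M (\<lambda>x. x)" and mean: "expectation (\<lambda>x. x) = 0"
    and int2: "integrable M (\<lambda>x. x\<^sup>2)" and var: "expectation (\<lambda>x. x\<^sup>2) = v"
  shows "(\<lambda>N. char M (t / sqrt (real N)) ^ N) \<longlonglongrightarrow> exp (- (v * t\<^sup>2 / 2))"
proof -
  define r where "r N = expectation (\<lambda>x. min (6 * x\<^sup>2) (\<bar>t / sqrt (real N)\<bar> * \<bar>x\<bar> ^ 3))" for N :: nat
  define w where "w N = 1 + (- (v * t\<^sup>2 / 2)) / real N" for N :: nat
  have v: "v \<ge> 0" unfolding var[symmetric] by simp
  have "(\<lambda>N. min (6 * x\<^sup>2) (\<bar>t / sqrt (real N)\<bar> * \<bar>x\<bar> ^ 3)) \<longlonglongrightarrow> min (6 * x\<^sup>2) (0 * \<bar>x\<bar> ^ 3)" for x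
  proof (intro tendsto_intros)
    have "(\<lambda>N. t / sqrt (real N)) \<longlonglongrightarrow> 0"
      by (rule tendsto_divide_0[OF tendsto_const])
        (intro filterlim_at_top_imp_at_infinity filterlim_compose[OF sqrt_at_top] filterlim_real_sequentially)
    then show "(\<lambda>N. \<bar>t / sqrt (real N)\<bar>) \<longlonglongrightarrow> 0" by (rule tendsto_rabs_zero)
  qed
  then have "r \<longlonglongrightarrow> (\<integral>x. 0 \<partial>M)"
    unfolding r_def
    by (intro integral_dominated_convergence[where w = "\<lambda>x. 6 * x\<^sup>2"])
      (use int2 in \<open>auto simp: min_absorb2\<close>)
  then have r0: "(\<lambda>N. t\<^sup>2 / 6 * r N) \<longlonglongrightarrow> 0"
    by (auto intro: tendsto_mult_right_zero)
  have le: "cmod (char M (t / sqrt (real N)) ^ N - complex_of_real (w N ^ N)) \<le> t\<^sup>2 / 6 * r N"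
    if N: "N > 0" "v * t\<^sup>2 / 4 \<le> real N" for N
  proof -
    have "cmod (char M (t / sqrt (real N)) - (1 - (t / sqrt (real N))\<^sup>2 * v / 2)) \<le> (t / sqrt (real N))\<^sup>2 / 6 * r N"
      unfolding r_def by (rule char_approx3) (use assms in auto)
    also have "1 - (t / sqrt (real N))\<^sup>2 * v / 2 = w N"
      by (simp add: w_def power_divide mult.commute)
    finally have step: "cmod (char M (t / sqrt (real N)) - complex_of_real (w N)) \<le> t\<^sup>2 / real N / 6 * r N"
      by (simp add: power_divide)
    have "v * t\<^sup>2 / 2 / real N \<le> 2" using N by (simp add: divide_le_eq)
    moreover have "0 \<le> v * t\<^sup>2 / 2 / real N" using v by simp
    ultimately have "\<bar>w N\<bar> \<le> 1" by (simp add: w_def abs_le_iff)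
    then have "cmod (complex_of_real (w N)) \<le> 1" by simp
    then have "cmod (char M (t / sqrt (real N)) ^ N - complex_of_real (w N) ^ N)
      \<le> real N * cmod (char M (t / sqrt (real N)) - complex_of_real (w N))"
      by (intro norm_power_diff cmod_char_le_1)
    also have "\<dots> \<le> real N * (t\<^sup>2 / real N / 6 * r N)"
      by (rule mult_left_mono[OF step]) simp
    also have "\<dots> = t\<^sup>2 / 6 * r N" using N by simp
    finally show ?thesis by simp
  qed
  \<comment> \<open>From this point on \<open>\<bar>w N\<bar> \<le> 1\<close>, which the estimate of a difference of powers requires.\<close>
  have "\<forall>\<^sub>F N in sequentially. N > 0 \<and> v * t\<^sup>2 / 4 \<le> real N"
    using eventually_gt_at_top[of 0] eventually_ge_at_top[of "nat \<lceil>v * t\<^sup>2 / 4\<rceil>"]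
    by eventually_elim (simp add: nat_ceiling_le_eq)
  then have "\<forall>\<^sub>F N in sequentially. cmod (char M (t / sqrt (real N)) ^ N - complex_of_real (w N ^ N)) \<le> t\<^sup>2 / 6 * r N"
    by eventually_elim (use le in blast)
  then have "(\<lambda>N. char M (t / sqrt (real N)) ^ N - complex_of_real (w N ^ N)) \<longlonglongrightarrow> 0"
    using r0 by (rule Lim_null_comparison)
  from tendsto_add[OF this, of "\<lambda>N. complex_of_real (w N ^ N)"]
  have "(\<lambda>N. char M (t / sqrt (real N)) ^ N) \<longlonglongrightarrow> 0 + l"
    if "(\<lambda>N. complex_of_real (w N ^ N)) \<longlonglongrightarrow> l" for l
    using that by simp
  moreover have "(\<lambda>N. complex_of_real (w N ^ N)) \<longlonglongrightarrow> complex_of_real (exp (- (v * t\<^sup>2 / 2)))"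
    unfolding w_def by (intro tendsto_of_real tendsto_exp_limit_sequentially)
  ultimately show ?thesis by (metis add_0)
qed

lemma (in square_integrable_levy_process) char_L_power_tendsto:
  assumes "0 \<le> h"
  shows "(\<lambda>N. char (distr M borel (L h)) (t / sqrt (real N)) ^ N) \<longlonglongrightarrow> exp (- (\<sigma>\<^sup>2 * h * t\<^sup>2 / 2))"
proof -
  have [measurable]: "L h \<in> borel_measurable M" using assms by simp
  interpret D: real_distribution "distr M borel (L h)" by (rule real_distribution_distr) simp
  show ?thesis
    by (rule D.char_power_tendsto)
      (use assms in \<open>simp_all add: integrable_distr_eq integral_distr mean_zero second_moment_L L_square_integrable\<close>)
qed

lemma cmod_cis_diff_le: "cmod (cis a - cis b) \<le> \<bar>a - b\<bar>"
proof -
  have "cis a - cis b = cis b * (iexp (a - b) - 1)"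
    by (simp add: right_diff_distrib cis_conv_exp flip: exp_add)
  then show ?thesis using iexp_approx1[of "a - b" 0] by (simp add: norm_mult)
qed

text \<open>On the event that the variables are \<open>\<epsilon>\<close>-close the Lipschitz bound applies, on its complement the
sup norm.\<close>

lemma (in prob_space) expectation_tendsto_of_in_prob:
  fixes X :: "'i \<Rightarrow> 'a \<Rightarrow> 'b::{metric_space, second_countable_topology}" and f :: "'b \<Rightarrow> complex"
  assumes X [measurable]: "\<And>i. X i \<in> borel_measurable M" and Y [measurable]: "Y \<in> borel_measurable M"
    and f [measurable]: "f \<in> borel_measurable borel" and bound: "\<And>y. cmod (f y) \<le> 1"
    and lip: "\<And>y z. cmod (f y - f z) \<le> K * dist y z" and "K \<ge> 0"
    and conv: "tendsto_in_prob M X Y G"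
  shows "((\<lambda>i. \<integral>x. f (X i x) \<partial>M) \<longlongrightarrow> (\<integral>x. f (Y x) \<partial>M)) G"
proof (rule tendstoI)
  fix e :: real assume "e > 0"
  define \<epsilon> where "\<epsilon> = e / (2 * (K + 1))"
  have \<epsilon>: "\<epsilon> > 0" "K * \<epsilon> \<le> e / 2"
    using \<open>e > 0\<close> \<open>K \<ge> 0\<close> by (auto simp: \<epsilon>_def divide_simps mult_right_mono)
  have int: "integrable M (\<lambda>x. f (Z x))" if "Z \<in> borel_measurable M" for Z
    using that by (intro integrable_const_bound[where B=1]) (auto simp: bound)
  have "((\<lambda>i. prob {x \<in> space M. dist (X i x) (Y x) > \<epsilon>}) \<longlongrightarrow> 0) G"
    using conv \<open>\<epsilon> > 0\<close> by (simp add: tendsto_in_prob_def)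
  then have "\<forall>\<^sub>F i in G. prob {x \<in> space M. dist (X i x) (Y x) > \<epsilon>} < e / 4"
    using \<open>e > 0\<close> by (intro order_tendstoD) auto
  then show "\<forall>\<^sub>F i in G. dist (\<integral>x. f (X i x) \<partial>M) (\<integral>x. f (Y x) \<partial>M) < e"
  proof eventually_elim
    case (elim i)
    let ?A = "{x \<in> space M. dist (X i x) (Y x) > \<epsilon>}"
    have I1: "integrable M (\<lambda>x. 2 * indicator ?A x :: real)"
      by (intro integrable_mult_right integrable_real_indicator) (simp_all add: less_top[symmetric])
    have "dist (\<integral>x. f (X i x) \<partial>M) (\<integral>x. f (Y x) \<partial>M) = cmod (\<integral>x. f (X i x) - f (Y x) \<partial>M)"
      by (simp add: dist_norm int X Y)
    also have "\<dots> \<le> (\<integral>x. cmod (f (X i x) - f (Y x)) \<partial>M)" by (rule integral_norm_bound)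
    also have "\<dots> \<le> (\<integral>x. K * \<epsilon> + 2 * indicator ?A x \<partial>M)"
    proof (rule integral_mono)
      show "integrable M (\<lambda>x. cmod (f (X i x) - f (Y x)))"
        by (intro integrable_norm Bochner_Integration.integrable_diff int X Y)
      show "integrable M (\<lambda>x. K * \<epsilon> + 2 * indicator ?A x)"
        using I1 by (intro Bochner_Integration.integrable_add integrable_const)
      fix x assume x: "x \<in> space M"
      show "cmod (f (X i x) - f (Y x)) \<le> K * \<epsilon> + 2 * indicator ?A x"
      proof (cases "dist (X i x) (Y x) \<le> \<epsilon>")
        case True
        then have "K * dist (X i x) (Y x) \<le> K * \<epsilon>" using \<open>K \<ge> 0\<close> by (rule mult_left_mono)
        then show ?thesis using lip[of "X i x" "Y x"] True by simp
      next
        case False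
        have "cmod (f (X i x) - f (Y x)) \<le> 2"
          using norm_triangle_ineq4[of "f (X i x)" "f (Y x)"] bound[of "X i x"] bound[of "Y x"] by linarith
        moreover have "0 \<le> K * \<epsilon>" using \<open>K \<ge> 0\<close> \<open>\<epsilon> > 0\<close> by simp
        ultimately show ?thesis using False x by simp
      qed
    qed
    also have "\<dots> = K * \<epsilon> + 2 * prob ?A" using I1 by (simp add: prob_space)
    finally show ?case using elim \<epsilon> by linarith
  qed
qed

section \<open>Riemann sums of the oscillating integrand\<close>

definition osc :: "real \<Rightarrow> real \<Rightarrow> complex" where
  "osc \<omega> t = cis (- (\<omega> * t))"

definition grid :: "real \<Rightarrow> nat \<Rightarrow> nat \<Rightarrow> real" where
  "grid T n i = real i * (T / real n)"

abbreviation osc_step :: "real \<Rightarrow> real \<Rightarrow> nat \<Rightarrow> real \<Rightarrow> complex" where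
  "osc_step \<omega> T n \<equiv> step_fun n (grid T n) (\<lambda>i. osc \<omega> (grid T n i))"

abbreviation osc_sum :: "(real \<Rightarrow> 'a \<Rightarrow> real) \<Rightarrow> real \<Rightarrow> real \<Rightarrow> nat \<Rightarrow> 'a \<Rightarrow> complex" where
  "osc_sum L \<omega> T n \<equiv> step_integral L n (grid T n) (\<lambda>i. osc \<omega> (grid T n i))"

lemma norm_osc [simp]: "cmod (osc \<omega> t) = 1"
  by (simp add: osc_def)

lemma osc_lipschitz: "cmod (osc \<omega> s - osc \<omega> t) \<le> \<bar>\<omega>\<bar> * \<bar>s - t\<bar>"
proof -
  have "cmod (osc \<omega> s - osc \<omega> t) \<le> \<bar>(- (\<omega> * s)) - (- (\<omega> * t))\<bar>"
    unfolding osc_def by (rule cmod_cis_diff_le)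
  also have "\<dots> = \<bar>\<omega>\<bar> * \<bar>s - t\<bar>"
    by (simp flip: abs_mult) (simp add: algebra_simps abs_minus_commute)
  finally show ?thesis .
qed

lemma grid_Suc: "grid T n (Suc i) = grid T n i + T / real n"
  by (simp only: grid_def of_nat_Suc distrib_right mult_1_left add.commute)

lemma subdivision_grid: "0 \<le> T \<Longrightarrow> n > 0 \<Longrightarrow> subdivision T n (grid T n)"
  by (auto simp: subdivision_def grid_Suc) (auto simp: grid_def)

lemma osc_step_norm_le:
  assumes "0 \<le> T" "n > 0"
  shows "cmod (osc_step \<omega> T n t) \<le> 1"
proof (cases "t \<in> {0<..T}")
  case True
  then obtain i where "osc_step \<omega> T n t = osc \<omega> (grid T n i)"
    using step_fun_inside[OF subdivision_grid[OF assms], of t] by auto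
  then show ?thesis by simp
qed (simp add: step_fun_outside[OF subdivision_grid[OF assms]])

lemma osc_step_close:
  assumes "0 \<le> T" "n > 0" "t \<in> {0<..T}"
  shows "cmod (osc_step \<omega> T n t - osc \<omega> t) \<le> \<bar>\<omega>\<bar> * (T / real n)"
proof -
  obtain i where i: "grid T n i < t" "t \<le> grid T n (Suc i)" "osc_step \<omega> T n t = osc \<omega> (grid T n i)"
    using step_fun_inside[OF subdivision_grid[OF assms(1,2)], of t] assms(3) by auto
  have "\<bar>grid T n i - t\<bar> \<le> T / real n"
    using i(1,2) unfolding grid_Suc by linarith
  then have "\<bar>\<omega>\<bar> * \<bar>grid T n i - t\<bar> \<le> \<bar>\<omega>\<bar> * (T / real n)" by (rule mult_left_mono) simp
  then show ?thesis using osc_lipschitz[of \<omega> "grid T n i" t] i(3) by simp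
qed

lemma osc_step_uniform_limit:
  assumes "0 \<le> T"
  shows "uniform_limit {0<..T} (\<lambda>k. osc_step \<omega> T (Suc k)) (osc \<omega>) sequentially"
proof (rule uniform_limitI)
  fix e :: real assume "e > 0"
  have "(\<lambda>k. \<bar>\<omega>\<bar> * (T / real (Suc k))) \<longlonglongrightarrow> \<bar>\<omega>\<bar> * 0"
    by (intro tendsto_mult_left LIMSEQ_Suc[OF lim_const_over_n])
  then have "\<forall>\<^sub>F k in sequentially. \<bar>\<omega>\<bar> * (T / real (Suc k)) < e"
    using \<open>e > 0\<close> by (intro order_tendstoD) auto
  then show "\<forall>\<^sub>F k in sequentially. \<forall>t\<in>{0<..T}. dist (osc_step \<omega> T (Suc k) t) (osc \<omega> t) < e"
  proof eventually_elim
    case (elim k)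
    show ?case
    proof
      fix t assume "t \<in> {0<..T}"
      then have "cmod (osc_step \<omega> T (Suc k) t - osc \<omega> t) \<le> \<bar>\<omega>\<bar> * (T / real (Suc k))"
        by (intro osc_step_close assms) auto
      then show "dist (osc_step \<omega> T (Suc k) t) (osc \<omega> t) < e"
        using elim unfolding dist_norm by (rule le_less_trans)
    qed
  qed
qed

lemma cmod_scaled_diff_le:
  fixes x y z :: complex
  assumes "0 \<le> v" "0 \<le> v - u"
  shows "cmod (complex_of_real u * x - complex_of_real v * y)
    \<le> v * (cmod (x - z) + cmod (y - z)) + (v - u) * cmod x"
proof -
  have "complex_of_real u * x - complex_of_real v * y
      = complex_of_real v * ((x - z) - (y - z)) - complex_of_real (v - u) * x"
    by (simp add: algebra_simps)
  then have "cmod (complex_of_real u * x - complex_of_real v * y)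
      \<le> cmod (complex_of_real v * ((x - z) - (y - z))) + cmod (complex_of_real (v - u) * x)"
    by (simp only: norm_triangle_ineq4)
  also have "\<dots> = v * cmod ((x - z) - (y - z)) + (v - u) * cmod x"
    by (simp only: norm_mult norm_of_real abs_of_nonneg assms)
  also have "\<dots> \<le> v * (cmod (x - z) + cmod (y - z)) + (v - u) * cmod x"
    by (intro add_right_mono mult_left_mono norm_triangle_ineq4 assms)
  finally show ?thesis .
qed

text \<open>Normalised Riemann sums over two horizons are compared in \<open>L\<^sup>2\<close> of the time axis. The three terms of
the bound come from the different normalisations on \<open>(0, T']\<close>, from the two discretisations, and from
the remaining time \<open>(T', T]\<close>.\<close>

lemma osc_step_scaled_L2_dist:
  assumes "0 < T'" "T' \<le> T" "n > 0" "n' > 0"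
    and int: "integrable lborel (\<lambda>t. (cmod (complex_of_real (1 / sqrt T) * osc_step \<omega> T n t
      - complex_of_real (1 / sqrt T') * osc_step \<omega> T' n' t))\<^sup>2)"
  shows "(\<integral>t. (cmod (complex_of_real (1 / sqrt T) * osc_step \<omega> T n t
      - complex_of_real (1 / sqrt T') * osc_step \<omega> T' n' t))\<^sup>2 \<partial>lborel)
    \<le> 2 * (1 - sqrt (T' / T))\<^sup>2 + 2 * (\<bar>\<omega>\<bar> * (T / real n) + \<bar>\<omega>\<bar> * (T' / real n'))\<^sup>2 + (1 - T' / T)"
proof -
  have T: "0 < T" using assms by simp
  let ?A = "1 / sqrt T' - 1 / sqrt T"
  define \<delta> where "\<delta> = \<bar>\<omega>\<bar> * (T / real n) + \<bar>\<omega>\<bar> * (T' / real n')"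
  let ?z = "\<lambda>t. complex_of_real (1 / sqrt T) * osc_step \<omega> T n t - complex_of_real (1 / sqrt T') * osc_step \<omega> T' n' t"
  let ?B = "\<lambda>t. (2 * ?A\<^sup>2 + 2 * (\<delta> / sqrt T')\<^sup>2) * indicator {0<..T'} t + 1 / T * indicator {T'<..T} t"
  have A: "0 \<le> ?A" using assms by (simp add: frac_le)
  have pointwise: "(cmod (?z t))\<^sup>2 \<le> ?B t" for t
  proof -
    have "t \<in> {0<..T'} \<or> t \<in> {T'<..T} \<or> t \<notin> {0<..T}" by auto
    then consider "t \<in> {0<..T'}" | "t \<in> {T'<..T}" | "t \<notin> {0<..T}" by blast
    then show ?thesis
    proof cases
      case 1
      then have "t \<in> {0<..T}" using assms by auto
      have "cmod (?z t) \<le> 1 / sqrt T' * (cmod (osc_step \<omega> T n t - osc \<omega> t) + cmod (osc_step \<omega> T' n' t - osc \<omega> t))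
          + ?A * cmod (osc_step \<omega> T n t)"
        by (rule cmod_scaled_diff_le) (use A assms in simp_all)
      also have "\<dots> \<le> 1 / sqrt T' * \<delta> + ?A * 1"
      proof (rule add_mono; rule mult_left_mono)
        show "cmod (osc_step \<omega> T n t - osc \<omega> t) + cmod (osc_step \<omega> T' n' t - osc \<omega> t) \<le> \<delta>"
          unfolding \<delta>_def using assms T 1 \<open>t \<in> {0<..T}\<close> by (intro add_mono osc_step_close) simp_all
        show "cmod (osc_step \<omega> T n t) \<le> 1" using assms T by (intro osc_step_norm_le) simp_all
      qed (use assms A in simp_all)
      finally have "cmod (?z t) \<le> \<delta> / sqrt T' + ?A" by simp
      then have "(cmod (?z t))\<^sup>2 \<le> (\<delta> / sqrt T' + ?A)\<^sup>2" by (rule power_mono) simp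
      also have "\<dots> \<le> 2 * ?A\<^sup>2 + 2 * (\<delta> / sqrt T')\<^sup>2"
        using sum_squares_bound[of "\<delta> / sqrt T'" ?A] unfolding power2_sum by linarith
      finally show ?thesis using 1 by simp
    next
      case 2
      then have "?z t = complex_of_real (1 / sqrt T) * osc_step \<omega> T n t"
        using step_fun_outside[OF subdivision_grid, of T' n' t] assms by simp
      then have "cmod (?z t) = 1 / sqrt T * cmod (osc_step \<omega> T n t)"
        using less_imp_le[OF T] by (simp only:) (simp add: norm_mult norm_divide)
      also have "\<dots> \<le> 1 / sqrt T * 1" using T assms by (intro mult_left_mono osc_step_norm_le) auto
      finally have "(cmod (?z t))\<^sup>2 \<le> (1 / sqrt T)\<^sup>2" by (intro power_mono) auto
      then show ?thesis using 2 T assms by (simp add: power_divide)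
    next
      case 3
      then have "?z t = 0"
        using step_fun_outside[OF subdivision_grid, of T' n' t] step_fun_outside[OF subdivision_grid, of T n t] assms by auto
      then show ?thesis using T by simp
    qed
  qed
  have "(\<integral>t. (cmod (?z t))\<^sup>2 \<partial>lborel) \<le> (\<integral>t. ?B t \<partial>lborel)"
    by (rule integral_mono[OF int _ pointwise]) (use assms in simp)
  also have "\<dots> = (2 * ?A\<^sup>2 + 2 * (\<delta> / sqrt T')\<^sup>2) * T' + 1 / T * (T - T')"
    using assms by simp
  also have "\<dots> = 2 * (?A * sqrt T')\<^sup>2 + 2 * \<delta>\<^sup>2 + (1 - T' / T)"
    using assms T by (simp add: power_mult_distrib power_divide distrib_right diff_divide_distrib)
  also have "?A * sqrt T' = 1 - sqrt (T' / T)"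
    using assms by (simp add: left_diff_distrib real_sqrt_divide)
  finally show ?thesis unfolding \<delta>_def .
qed

context square_integrable_levy_process begin

text \<open>Since \<open>cis\<close> is 1-Lipschitz, the isometry transfers the bound on the time axis to the characteristic
functions.\<close>

lemma osc_sum_scaled_char_dist:
  assumes "0 < T'" "T' \<le> T" "n > 0" "n' > 0"
  shows "cmod ((\<integral>x. cis (Re (d * osc_sum L \<omega> T n x) / sqrt T) \<partial>M)
      - (\<integral>x. cis (Re (d * osc_sum L \<omega> T' n' x) / sqrt T') \<partial>M))
    \<le> cmod d * \<bar>\<sigma>\<bar> * sqrt (2 * (1 - sqrt (T' / T))\<^sup>2
      + 2 * (\<bar>\<omega>\<bar> * (T / real n) + \<bar>\<omega>\<bar> * (T' / real n'))\<^sup>2 + (1 - T' / T))"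
    (is "_ \<le> cmod d * \<bar>\<sigma>\<bar> * sqrt ?R")
proof -
  have sub: "subdivision T n (grid T n)" "subdivision T' n' (grid T' n')"
    using assms by (auto intro: subdivision_grid)
  note [measurable] = sub[THEN step_integral_measurable]
  let ?\<alpha> = "complex_of_real (1 / sqrt T)" and ?\<beta> = "complex_of_real (1 / sqrt T')"
  let ?D = "\<lambda>x. ?\<alpha> * osc_sum L \<omega> T n x - ?\<beta> * osc_sum L \<omega> T' n' x"
  note iso = step_integral_diff_isometry[OF sub, where \<alpha> = ?\<alpha> and \<beta> = ?\<beta>]
  have cis_int: "integrable M (\<lambda>x. cis (f x))" if "f \<in> borel_measurable M" for f
    using that by (intro integrable_const_bound[where B=1]) (auto simp: cis_conv_exp)
  note D1 = expectation_norm_le_sqrt[OF _ iso(1)]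
  have "cmod ((\<integral>x. cis (Re (d * osc_sum L \<omega> T n x) / sqrt T) \<partial>M)
      - (\<integral>x. cis (Re (d * osc_sum L \<omega> T' n' x) / sqrt T') \<partial>M))
    = cmod (\<integral>x. cis (Re (d * osc_sum L \<omega> T n x) / sqrt T) - cis (Re (d * osc_sum L \<omega> T' n' x) / sqrt T') \<partial>M)"
    by (subst Bochner_Integration.integral_diff) (auto intro!: cis_int)
  also have "\<dots> \<le> (\<integral>x. cmod (cis (Re (d * osc_sum L \<omega> T n x) / sqrt T) - cis (Re (d * osc_sum L \<omega> T' n' x) / sqrt T')) \<partial>M)"
    by (rule integral_norm_bound)
  also have "\<dots> \<le> (\<integral>x. cmod d * cmod (?D x) \<partial>M)"
  proof (rule integral_mono)
    show "integrable M (\<lambda>x. cmod (cis (Re (d * osc_sum L \<omega> T n x) / sqrt T) - cis (Re (d * osc_sum L \<omega> T' n' x) / sqrt T')))"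
      by (intro integrable_norm Bochner_Integration.integrable_diff cis_int) auto
    show "integrable M (\<lambda>x. cmod d * cmod (?D x))"
      by (intro integrable_mult_right D1(1)) measurable
    fix x
    have "Re (d * osc_sum L \<omega> T n x) / sqrt T - Re (d * osc_sum L \<omega> T' n' x) / sqrt T' = Re (d * ?D x)"
      by (simp add: algebra_simps diff_divide_distrib)
    then have "cmod (cis (Re (d * osc_sum L \<omega> T n x) / sqrt T) - cis (Re (d * osc_sum L \<omega> T' n' x) / sqrt T'))
      \<le> \<bar>Re (d * ?D x)\<bar>" using cmod_cis_diff_le by metis
    also have "\<dots> \<le> cmod d * cmod (?D x)" using abs_Re_le_cmod[of "d * ?D x"] by (simp only: norm_mult)
    finally show "cmod (cis (Re (d * osc_sum L \<omega> T n x) / sqrt T) - cis (Re (d * osc_sum L \<omega> T' n' x) / sqrt T'))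
      \<le> cmod d * cmod (?D x)" .
  qed
  also have "\<dots> = cmod d * (\<integral>x. cmod (?D x) \<partial>M)" by (rule integral_mult_right_zero)
  also have "\<dots> \<le> cmod d * sqrt (\<integral>x. (cmod (?D x))\<^sup>2 \<partial>M)"
    by (intro mult_left_mono D1(2)) auto
  also have "\<dots> \<le> cmod d * sqrt (\<sigma>\<^sup>2 * ?R)"
    unfolding iso(3) using osc_step_scaled_L2_dist[OF assms iso(2)]
    by (intro mult_left_mono real_sqrt_le_mono) auto
  also have "\<dots> = cmod d * \<bar>\<sigma>\<bar> * sqrt ?R" by (simp only: real_sqrt_mult real_sqrt_abs mult.assoc)
  finally show ?thesis .
qed

end

section \<open>The central limit theorem for the oscillatory integral\<close>

lemma prod_periodic:
  fixes f :: "nat \<Rightarrow> 'a::comm_monoid_mult"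
  assumes "\<And>i. f (i + m) = f i"
  shows "(\<Prod>i<N * m. f i) = (\<Prod>i<m. f i) ^ N"
proof -
  have shift: "f (i + j * m) = f i" for i j
    by (induction j) (simp_all add: assms add.assoc[symmetric] add.commute[of m])
  have "(\<Prod>i<N * m. f i) = (\<Prod>j<N. prod f {j * m..<j * m + m})"
    by (rule prod.nat_group[symmetric])
  also have "\<dots> = (\<Prod>j<N. \<Prod>i<m. f i)"
  proof (rule prod.cong[OF refl])
    fix j
    have "prod f {0 + j * m..<m + j * m} = prod (\<lambda>i. f (i + j * m)) {0..<m}"
      by (rule prod.shift_bounds_nat_ivl)
    then show "prod f {j * m..<j * m + m} = (\<Prod>i<m. f i)"
      by (simp add: shift add.commute lessThan_atLeast0)
  qed
  finally show ?thesis by simp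
qed

text \<open>As \<open>(Re w)\<^sup>2 = (\<bar>w\<bar>\<^sup>2 + Re (w\<^sup>2)) / 2\<close>, what remains besides the main term is a sum of powers of the
square of a primitive \<open>m\<close>-th root of unity. That square differs from 1 exactly because \<open>m \<ge> 3\<close>, so
the geometric sum vanishes. This is why the limiting covariance is the same in all directions.\<close>

lemma sum_Re_roots_of_unity_squared:
  fixes d :: complex
  assumes "m \<ge> 3"
  shows "(\<Sum>j<m. (Re (d * cis (- (2 * pi / real m)) ^ j))\<^sup>2) = real m * (cmod d)\<^sup>2 / 2"
proof -
  let ?z = "cis (- (2 * pi / real m))"
  have ne: "?z\<^sup>2 \<noteq> 1"
  proof
    assume "?z\<^sup>2 = 1"
    then have "cis (- (4 * pi / real m)) = 1" by (simp add: Complex.DeMoivre)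
    then have "cos (4 * pi / real m) = 1" by (simp add: complex_eq_iff)
    then obtain k :: int where "4 * pi / real m = of_int k * 2 * pi"
      unfolding cos_one_2pi_int by blast
    then have "2 / real m = of_int k" using assms by (simp add: field_simps)
    moreover have "0 < 2 / real m" "2 / real m < 1" using assms by simp_all
    ultimately show False by simp
  qed
  have "(?z\<^sup>2) ^ m = cis (- (2 * pi)) ^ 2"
    using assms by (simp add: Complex.DeMoivre power_mult[symmetric] mult.commute)
  also have "\<dots> = 1" by (simp add: complex_eq_iff power2_eq_square)
  finally have "(\<Sum>j<m. (?z\<^sup>2) ^ j) = 0" using ne by (simp add: geometric_sum)
  moreover have square_eq: "(Re (d * ?z ^ j))\<^sup>2 = (cmod d)\<^sup>2 / 2 + Re (d\<^sup>2 * (?z\<^sup>2) ^ j) / 2" for j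
  proof -
    have half: "(Re w)\<^sup>2 = (cmod w)\<^sup>2 / 2 + Re (w\<^sup>2) / 2" for w
    proof -
      have "Re (w\<^sup>2) = (Re w)\<^sup>2 - (Im w)\<^sup>2" by (simp add: power2_eq_square)
      then show ?thesis by (simp only: cmod_power2) (simp add: field_simps)
    qed
    have "(d * ?z ^ j)\<^sup>2 = d\<^sup>2 * (?z\<^sup>2) ^ j"
      by (simp only: power_mult_distrib power_mult[symmetric] mult.commute[of j])
    moreover have "cmod (d * ?z ^ j) = cmod d" by (simp add: norm_mult norm_power)
    ultimately show ?thesis using half[of "d * ?z ^ j"] by (simp only:)
  qed
  have "(\<Sum>j<m. (Re (d * ?z ^ j))\<^sup>2) = real m * ((cmod d)\<^sup>2 / 2) + Re (d\<^sup>2 * (\<Sum>j<m. (?z\<^sup>2) ^ j)) / 2"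
    unfolding square_eq
    by (simp only: sum.distrib sum_distrib_left Re_sum sum_divide_distrib sum_constant card_lessThan)
  ultimately show ?thesis by simp
qed

context square_integrable_levy_process begin

context
  fixes \<omega> :: real and m :: nat
  assumes \<omega>: "\<omega> > 0" and m: "m \<ge> 3"
begin

lemma osc_grid_period:
  "osc \<omega> (real j * (2 * pi / \<omega> / real m)) = cis (- (2 * pi / real m)) ^ j"
  using \<omega> by (simp add: osc_def Complex.DeMoivre)

text \<open>A Riemann sum over \<open>N\<close> full periods with \<open>m\<close> points per period has the same weights in every period.
Grouping the independent increments by their position in the period gives \<open>m\<close> factors, each an
\<open>N\<close>-th power.\<close>

lemma osc_sum_periods_char:
  assumes "N > 0"
  shows "(\<integral>x. cis (Re (d * osc_sum L \<omega> (real N * (2 * pi / \<omega>)) (N * m) x) / sqrt (real N * (2 * pi / \<omega>))) \<partial>M)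
    = (\<Prod>j<m. char (distr M borel (L (2 * pi / \<omega> / real m)))
        (Re (d * cis (- (2 * pi / real m)) ^ j) / sqrt (2 * pi / \<omega>) / sqrt (real N)) ^ N)"
proof -
  define h where "h = 2 * pi / \<omega> / real m"
  define r where "r = sqrt (real N * (2 * pi / \<omega>))"
  define g where "g j = Re (d * cis (- (2 * pi / real m)) ^ j) / sqrt (2 * pi / \<omega>) / sqrt (real N)" for j :: nat
  have g_eq: "g j = Re (d * cis (- (2 * pi / real m)) ^ j) / r" for j
    by (simp only: g_def r_def real_sqrt_mult divide_divide_eq_left mult.commute)
  have h: "0 \<le> h" using \<omega> by (simp add: h_def)
  have grid: "grid (real N * (2 * pi / \<omega>)) (N * m) j = real j * h" for j
    using assms by (simp add: grid_def h_def)
  have "Re (d * osc_sum L \<omega> (real N * (2 * pi / \<omega>)) (N * m) x) / r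
    = (\<Sum>j<N * m. g j * (L (real (Suc j) * h) x - L (real j * h) x))" for x
  proof -
    have "d * osc_sum L \<omega> (real N * (2 * pi / \<omega>)) (N * m) x
      = (\<Sum>j<N * m. (d * cis (- (2 * pi / real m)) ^ j) * complex_of_real (L (real (Suc j) * h) x - L (real j * h) x))"
      unfolding step_integral_def grid osc_grid_period[folded h_def] sum_distrib_left by (simp only: mult.assoc)
    moreover have "Re (z * complex_of_real y) = Re z * y" for z y by simp
    ultimately show ?thesis
      by (simp only: Re_sum sum_divide_distrib g_eq times_divide_eq_left)
  qed
  then have "(\<integral>x. cis (Re (d * osc_sum L \<omega> (real N * (2 * pi / \<omega>)) (N * m) x) / r) \<partial>M)
    = (\<Prod>j<N * m. char (distr M borel (L h)) (g j))"
    using char_weighted_increments[OF h, of g "N * m"] by simp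
  also have "\<dots> = (\<Prod>j<m. char (distr M borel (L h)) (g j)) ^ N"
  proof (rule prod_periodic)
    have "cis (- (2 * pi / real m)) ^ m = 1"
      using m by (simp add: Complex.DeMoivre complex_eq_iff)
    then show "char (distr M borel (L h)) (g (i + m)) = char (distr M borel (L h)) (g i)" for i
      by (simp add: g_def power_add)
  qed
  also have "\<dots> = (\<Prod>j<m. char (distr M borel (L h)) (g j) ^ N)" by (rule prod_power_distrib)
  finally show ?thesis unfolding h_def g_def r_def .
qed

text \<open>For every \<open>m \<ge> 3\<close> the limit is already the final one, since the squares of the weights have the same
mean as in continuous time.\<close>

lemma osc_sum_periods_char_tendsto:
  "(\<lambda>N. \<integral>x. cis (Re (d * osc_sum L \<omega> (real N * (2 * pi / \<omega>)) (N * m) x) / sqrt (real N * (2 * pi / \<omega>))) \<partial>M)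
    \<longlonglongrightarrow> exp (- (\<sigma>\<^sup>2 * (cmod d)\<^sup>2 / 4))"
proof -
  define \<tau> where "\<tau> = 2 * pi / \<omega>"
  define g where "g j = Re (d * cis (- (2 * pi / real m)) ^ j)" for j :: nat
  have \<tau>: "\<tau> > 0" using \<omega> by (simp add: \<tau>_def)
  have "(\<lambda>N. \<Prod>j<m. char (distr M borel (L (\<tau> / real m))) (g j / sqrt \<tau> / sqrt (real N)) ^ N)
    \<longlonglongrightarrow> (\<Prod>j<m. complex_of_real (exp (- (\<sigma>\<^sup>2 * (\<tau> / real m) * (g j / sqrt \<tau>)\<^sup>2 / 2))))"
    using \<tau> by (intro tendsto_prod char_L_power_tendsto) simp
  moreover have "\<forall>\<^sub>F N in sequentially. (\<Prod>j<m. char (distr M borel (L (\<tau> / real m))) (g j / sqrt \<tau> / sqrt (real N)) ^ N)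
    = (\<integral>x. cis (Re (d * osc_sum L \<omega> (real N * \<tau>) (N * m) x) / sqrt (real N * \<tau>)) \<partial>M)"
    using eventually_gt_at_top[of 0]
    by eventually_elim (simp only: osc_sum_periods_char \<tau>_def g_def)
  ultimately have "(\<lambda>N. \<integral>x. cis (Re (d * osc_sum L \<omega> (real N * \<tau>) (N * m) x) / sqrt (real N * \<tau>)) \<partial>M)
    \<longlonglongrightarrow> (\<Prod>j<m. complex_of_real (exp (- (\<sigma>\<^sup>2 * (\<tau> / real m) * (g j / sqrt \<tau>)\<^sup>2 / 2))))"
    by (rule Lim_transform_eventually)
  also have "(\<Prod>j<m. complex_of_real (exp (- (\<sigma>\<^sup>2 * (\<tau> / real m) * (g j / sqrt \<tau>)\<^sup>2 / 2))))
    = complex_of_real (exp (\<Sum>j<m. - (\<sigma>\<^sup>2 / (2 * real m)) * (g j)\<^sup>2))"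
    using \<tau> by (simp add: exp_sum power_divide mult.commute del: of_real_exp)
  also have "(\<Sum>j<m. - (\<sigma>\<^sup>2 / (2 * real m)) * (g j)\<^sup>2) = - (\<sigma>\<^sup>2 * (cmod d)\<^sup>2 / 4)"
    unfolding sum_distrib_left[symmetric] g_def sum_Re_roots_of_unity_squared[OF m]
    using m by (simp add: field_simps)
  finally show ?thesis by (simp add: \<tau>_def)
qed

end

text \<open>The stochastic integral is the limit in probability of Riemann sums on ever finer grids; in the limit
the discretisation error of the first sum disappears from the bound.\<close>

lemma levy_integral_char_dist:
  assumes I: "is_levy_integral M L (osc \<omega>) T I" and T: "0 < T'" "T' \<le> T" and "n' > 0"
  shows "cmod ((\<integral>x. cis (Re (d * I x) / sqrt T) \<partial>M)
      - (\<integral>x. cis (Re (d * osc_sum L \<omega> T' n' x) / sqrt T') \<partial>M))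
    \<le> cmod d * \<bar>\<sigma>\<bar> * sqrt (2 * (1 - sqrt (T' / T))\<^sup>2 + 2 * (\<bar>\<omega>\<bar> * (T' / real n'))\<^sup>2 + (1 - T' / T))"
proof (rule LIMSEQ_le)
  have "0 < T" using T by simp
  have sub: "subdivision T (Suc k) (grid T (Suc k))" for k
    using \<open>0 < T\<close> by (intro subdivision_grid) auto
  have I_meas: "I \<in> borel_measurable M" using I by (simp add: is_levy_integral_def)
  have conv: "tendsto_in_prob M (\<lambda>k. osc_sum L \<omega> T (Suc k)) I sequentially"
    using I sub osc_step_uniform_limit[of T \<omega>] \<open>0 < T\<close> unfolding is_levy_integral_def by simp
  define f where "f z = cis (Re (d * z) / sqrt T)" for z
  have "(\<lambda>k. \<integral>x. f (osc_sum L \<omega> T (Suc k) x) \<partial>M) \<longlonglongrightarrow> (\<integral>x. f (I x) \<partial>M)"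
  proof (rule expectation_tendsto_of_in_prob[OF step_integral_measurable[OF sub] I_meas _ _ _ _ conv])
    show "f \<in> borel_measurable borel"
      unfolding f_def by (intro borel_measurable_continuous_onI continuous_intros) (use \<open>0 < T\<close> in simp)
    show "cmod (f y) \<le> 1" for y by (simp add: f_def)
    show "cmod (f y - f z) \<le> (cmod d / sqrt T) * dist y z" for y z
    proof -
      have "cmod (f y - f z) \<le> \<bar>Re (d * y) / sqrt T - Re (d * z) / sqrt T\<bar>"
        unfolding f_def by (rule cmod_cis_diff_le)
      also have "\<dots> = \<bar>Re (d * (y - z))\<bar> / sqrt T"
        using \<open>0 < T\<close> by (simp only: right_diff_distrib minus_complex.sel diff_divide_distrib[symmetric] abs_divide) simp
      also have "\<dots> \<le> cmod (d * (y - z)) / sqrt T"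
        using \<open>0 < T\<close> by (intro divide_right_mono abs_Re_le_cmod) simp
      finally show ?thesis by (simp add: norm_mult dist_norm)
    qed
    show "0 \<le> cmod d / sqrt T" using \<open>0 < T\<close> by simp
  qed
  then show "(\<lambda>k. cmod ((\<integral>x. cis (Re (d * osc_sum L \<omega> T (Suc k) x) / sqrt T) \<partial>M)
      - (\<integral>x. cis (Re (d * osc_sum L \<omega> T' n' x) / sqrt T') \<partial>M)))
    \<longlonglongrightarrow> cmod ((\<integral>x. cis (Re (d * I x) / sqrt T) \<partial>M) - (\<integral>x. cis (Re (d * osc_sum L \<omega> T' n' x) / sqrt T') \<partial>M))"
    unfolding f_def by (intro tendsto_intros)
  have "(\<lambda>k. \<bar>\<omega>\<bar> * (T / real (Suc k))) \<longlonglongrightarrow> \<bar>\<omega>\<bar> * 0"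
    by (intro tendsto_mult_left LIMSEQ_Suc[OF lim_const_over_n])
  then have "(\<lambda>k. \<bar>\<omega>\<bar> * (T / real (Suc k))) \<longlonglongrightarrow> 0" by simp
  from tendsto_add[OF this tendsto_const]
  have "(\<lambda>k. \<bar>\<omega>\<bar> * (T / real (Suc k)) + \<bar>\<omega>\<bar> * (T' / real n')) \<longlonglongrightarrow> \<bar>\<omega>\<bar> * (T' / real n')" by simp
  then show "(\<lambda>k. cmod d * \<bar>\<sigma>\<bar> * sqrt (2 * (1 - sqrt (T' / T))\<^sup>2
      + 2 * (\<bar>\<omega>\<bar> * (T / real (Suc k)) + \<bar>\<omega>\<bar> * (T' / real n'))\<^sup>2 + (1 - T' / T)))
    \<longlonglongrightarrow> cmod d * \<bar>\<sigma>\<bar> * sqrt (2 * (1 - sqrt (T' / T))\<^sup>2 + 2 * (\<bar>\<omega>\<bar> * (T' / real n'))\<^sup>2 + (1 - T' / T))"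
    by (intro tendsto_mult tendsto_const tendsto_real_sqrt tendsto_add tendsto_power)
  show "\<exists>N. \<forall>k\<ge>N. cmod ((\<integral>x. cis (Re (d * osc_sum L \<omega> T (Suc k) x) / sqrt T) \<partial>M)
      - (\<integral>x. cis (Re (d * osc_sum L \<omega> T' n' x) / sqrt T') \<partial>M))
    \<le> cmod d * \<bar>\<sigma>\<bar> * sqrt (2 * (1 - sqrt (T' / T))\<^sup>2
      + 2 * (\<bar>\<omega>\<bar> * (T / real (Suc k)) + \<bar>\<omega>\<bar> * (T' / real n'))\<^sup>2 + (1 - T' / T))"
    using osc_sum_scaled_char_dist[OF T _ \<open>n' > 0\<close>] by blast
qed

text \<open>The horizon \<open>T\<close> is replaced by the largest multiple \<open>T'\<close> of the period \<open>2\<pi>/\<omega>\<close> below it, and the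
integrand by its values at \<open>m\<close> points per period. The first replacement costs nothing in the limit
because \<open>T' / T\<close> tends to 1; the second costs an error that is uniform in \<open>T\<close> and tends to 0 as
\<open>m\<close> grows.\<close>

lemma levy_integral_char_tendsto:
  assumes \<omega>: "\<omega> > 0" and I: "\<And>T. T > 0 \<Longrightarrow> is_levy_integral M L (osc \<omega>) T (I T)"
  shows "((\<lambda>T. \<integral>x. cis (Re (d * I T x) / sqrt T) \<partial>M) \<longlongrightarrow> exp (- (\<sigma>\<^sup>2 * (cmod d)\<^sup>2 / 4))) at_top"
proof (rule tendstoI)
  fix e :: real assume "e > 0"
  define \<tau> where "\<tau> = 2 * pi / \<omega>"
  have \<tau>: "\<tau> > 0" using \<omega> by (simp add: \<tau>_def)
  define C where "C = cmod d * \<bar>\<sigma>\<bar>"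
  have "(\<lambda>m. C * sqrt (2 * (2 * pi / real m)\<^sup>2)) \<longlonglongrightarrow> C * sqrt (2 * 0\<^sup>2)"
    by (intro tendsto_intros lim_const_over_n)
  then have "\<forall>\<^sub>F m in sequentially. C * sqrt (2 * (2 * pi / real m)\<^sup>2) < e / 2"
    using \<open>e > 0\<close> by (intro order_tendstoD) auto
  with eventually_ge_at_top[of 3]
  have "\<forall>\<^sub>F m in sequentially. m \<ge> 3 \<and> C * sqrt (2 * (2 * pi / real m)\<^sup>2) < e / 2" by eventually_elim simp
  then obtain m where m: "m \<ge> 3" "C * sqrt (2 * (2 * pi / real m)\<^sup>2) < e / 2"
    by (auto simp: eventually_sequentially)
  define N where "N T = nat \<lfloor>T / \<tau>\<rfloor>" for T
  define T' where "T' T = real (N T) * \<tau>" for T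
  have "filterlim (\<lambda>T. 1 / \<tau> * T) at_top at_top"
    using \<tau> by (intro filterlim_tendsto_pos_mult_at_top[OF tendsto_const _ filterlim_ident]) simp
  then have N_top: "filterlim N at_top at_top"
    unfolding N_def
    by (intro filterlim_compose[OF filterlim_nat_sequentially] filterlim_compose[OF filterlim_floor_sequentially]) simp
  have T'_le: "T' T \<le> T" "T - \<tau> \<le> T' T" if "T > 0" for T
  proof -
    have "real (N T) = of_int \<lfloor>T / \<tau>\<rfloor>" using that \<tau> by (simp add: N_def)
    then have "real (N T) \<le> T / \<tau>" "T / \<tau> - 1 \<le> real (N T)" by linarith+
    then show "T' T \<le> T" "T - \<tau> \<le> T' T" using \<tau> by (simp_all add: T'_def field_simps)
  qed
  have ratio: "((\<lambda>T. T' T / T) \<longlongrightarrow> 1) at_top"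
  proof (rule tendsto_sandwich)
    have "1 - \<tau> / T \<le> T' T / T \<and> T' T / T \<le> 1" if "T > 0" for T
      using divide_right_mono[OF T'_le(2)[OF that], of T] divide_right_mono[OF T'_le(1)[OF that], of T] that
      by (simp add: diff_divide_distrib)
    then show "\<forall>\<^sub>F T in at_top. 1 - \<tau> / T \<le> T' T / T" "\<forall>\<^sub>F T in at_top. T' T / T \<le> 1"
      by (auto intro: eventually_mono[OF eventually_gt_at_top[of 0]])
    show "((\<lambda>T. 1 - \<tau> / T) \<longlongrightarrow> 1) at_top"
      using tendsto_diff[OF tendsto_const tendsto_divide_0[OF tendsto_const filterlim_at_top_imp_at_infinity[OF filterlim_ident]], of 1 \<tau>] by simp
  qed simp
  let ?R = "\<lambda>T. C * sqrt (2 * (1 - sqrt (T' T / T))\<^sup>2 + 2 * (2 * pi / real m)\<^sup>2 + (1 - T' T / T))"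
  let ?\<phi> = "\<lambda>T. \<integral>x. cis (Re (d * I T x) / sqrt T) \<partial>M"
  let ?\<psi> = "\<lambda>N. \<integral>x. cis (Re (d * osc_sum L \<omega> (real N * \<tau>) (N * m) x) / sqrt (real N * \<tau>)) \<partial>M"
  let ?l = "complex_of_real (exp (- (\<sigma>\<^sup>2 * (cmod d)\<^sup>2 / 4)))"
  have "(?R \<longlongrightarrow> C * sqrt (2 * (1 - sqrt 1)\<^sup>2 + 2 * (2 * pi / real m)\<^sup>2 + (1 - 1))) at_top"
    by (intro tendsto_mult tendsto_const tendsto_real_sqrt tendsto_add tendsto_power tendsto_diff ratio)
  then have "\<forall>\<^sub>F T in at_top. ?R T < e / 2"
    using m(2) by (intro order_tendstoD(2)) simp
  moreover have "\<forall>\<^sub>F T in at_top. dist (?\<psi> (N T)) ?l < e / 2"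
  proof (rule tendstoD)
    have "?\<psi> \<longlonglongrightarrow> ?l"
      using osc_sum_periods_char_tendsto[OF \<omega> m(1), of d] by (simp only: \<tau>_def)
    then show "((\<lambda>T. ?\<psi> (N T)) \<longlongrightarrow> ?l) at_top" using N_top by (rule filterlim_compose)
  qed (use \<open>e > 0\<close> in simp)
  moreover have "\<forall>\<^sub>F T in at_top. N T > 0" using eventually_compose_filterlim[OF eventually_gt_at_top[of 0] N_top] .
  ultimately show "\<forall>\<^sub>F T in at_top. dist (?\<phi> T) ?l < e"
    using eventually_gt_at_top[of 0]
  proof eventually_elim
    case (elim T)
    have "\<bar>\<omega>\<bar> * (T' T / real (N T * m)) = 2 * pi / real m"
      using elim \<omega> by (simp add: T'_def \<tau>_def)
    moreover have "0 < T' T" "N T * m > 0" using elim \<tau> m by (simp_all add: T'_def)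
    ultimately have "cmod (?\<phi> T - ?\<psi> (N T)) \<le> ?R T"
      using levy_integral_char_dist[OF I[OF elim(4)], of "T' T" "N T * m" d] T'_le(1)[OF elim(4)]
      by (simp only: C_def T'_def)
    then have "dist (?\<phi> T) (?\<psi> (N T)) < e / 2"
      unfolding dist_norm using elim(1) by (rule le_less_trans)
    moreover have "dist ?l (?\<psi> (N T)) < e / 2" using elim(2) by (simp only: dist_commute)
    ultimately show ?case by (rule dist_triangle_half_l)
  qed
qed

text \<open>Chebyshev's inequality for the Riemann sums, whose second moments are at most \<open>\<sigma>\<^sup>2 T\<close>. The factor 2
leaves room for the distance between the integral and the sum.\<close>

lemma levy_integral_tail:
  assumes I: "is_levy_integral M L (osc \<omega>) T I" and "0 < T" "0 < R"
  shows "prob {x \<in> space M. cmod (I x) > 2 * R * sqrt T} \<le> \<sigma>\<^sup>2 / R\<^sup>2"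
proof (rule LIMSEQ_le_const)
  let ?J = "\<lambda>k. osc_sum L \<omega> T (Suc k)"
  have sub: "subdivision T (Suc k) (grid T (Suc k))" for k
    using \<open>0 < T\<close> by (intro subdivision_grid) auto
  note [measurable] = step_integral_measurable[OF sub]
  have [measurable]: "I \<in> borel_measurable M" using I by (simp add: is_levy_integral_def)
  have "tendsto_in_prob M ?J I sequentially"
    using I sub osc_step_uniform_limit[of T \<omega>] \<open>0 < T\<close> unfolding is_levy_integral_def by simp
  then have "(\<lambda>k. prob {x \<in> space M. dist (?J k x) (I x) > R * sqrt T}) \<longlonglongrightarrow> 0"
    using assms by (simp add: tendsto_in_prob_def)
  from tendsto_add[OF tendsto_const this]
  show "(\<lambda>k. \<sigma>\<^sup>2 / R\<^sup>2 + prob {x \<in> space M. dist (?J k x) (I x) > R * sqrt T}) \<longlonglongrightarrow> \<sigma>\<^sup>2 / R\<^sup>2"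
    by simp
  have "prob {x \<in> space M. cmod (I x) > 2 * R * sqrt T}
    \<le> \<sigma>\<^sup>2 / R\<^sup>2 + prob {x \<in> space M. dist (?J k x) (I x) > R * sqrt T}" for k
  proof -
    note iso = step_integral_diff_isometry[OF sub[of k] sub[of k], of 1 "\<lambda>i. osc \<omega> (grid T (Suc k) i)" 0, simplified]
    have "(\<integral>t. (cmod (osc_step \<omega> T (Suc k) t))\<^sup>2 \<partial>lborel) \<le> (\<integral>t. indicator {0<..T} t \<partial>lborel)"
    proof (rule integral_mono[OF iso(2)])
      show "integrable lborel (indicator {0<..T} :: real \<Rightarrow> real)" using \<open>0 < T\<close> by simp
      show "(cmod (osc_step \<omega> T (Suc k) t))\<^sup>2 \<le> indicator {0<..T} t" for t
        using osc_step_norm_le[of T "Suc k" \<omega> t] step_fun_outside[OF sub[of k], of t] \<open>0 < T\<close>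
        by (cases "t \<in> {0<..T}") (auto intro: power_le_one)
    qed
    also have "\<dots> = T" using \<open>0 < T\<close> by simp
    finally have second: "expectation (\<lambda>x. (cmod (?J k x))\<^sup>2) \<le> \<sigma>\<^sup>2 * T"
      unfolding iso(3) by (intro mult_left_mono) auto
    let ?A = "{x \<in> space M. (cmod (?J k x))\<^sup>2 \<ge> R\<^sup>2 * T}"
    let ?B = "{x \<in> space M. dist (?J k x) (I x) > R * sqrt T}"
    have "{x \<in> space M. cmod (I x) > 2 * R * sqrt T} \<subseteq> ?A \<union> ?B"
    proof
      fix x assume x: "x \<in> {x \<in> space M. cmod (I x) > 2 * R * sqrt T}"
      show "x \<in> ?A \<union> ?B"
      proof (rule ccontr)
        assume "x \<notin> ?A \<union> ?B"
        then have "(cmod (?J k x))\<^sup>2 < (R * sqrt T)\<^sup>2" "dist (?J k x) (I x) \<le> R * sqrt T"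
          using x \<open>0 < T\<close> by (auto simp: power_mult_distrib)
        then have "cmod (?J k x) < R * sqrt T" using assms by (simp add: power2_less_imp_less)
        then show False
          using x norm_triangle_ineq4[of "?J k x" "?J k x - I x"] \<open>dist (?J k x) (I x) \<le> R * sqrt T\<close>
          by (simp add: dist_norm)
      qed
    qed
    then have "prob {x \<in> space M. cmod (I x) > 2 * R * sqrt T} \<le> prob (?A \<union> ?B)"
      by (intro finite_measure_mono) auto
    also have "\<dots> \<le> prob ?A + prob ?B" by (rule measure_Un_le) auto
    also have "prob ?A \<le> expectation (\<lambda>x. (cmod (?J k x))\<^sup>2) / (R\<^sup>2 * T)"
      using assms iso(1) by (intro integral_Markov_inequality_measure[where A = "space M"]) auto
    also have "\<dots> \<le> \<sigma>\<^sup>2 * T / (R\<^sup>2 * T)"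
      using second assms by (intro divide_right_mono) auto
    also have "\<dots> = \<sigma>\<^sup>2 / R\<^sup>2" using assms by simp
    finally show ?thesis by simp
  qed
  then show "\<exists>N. \<forall>k\<ge>N. prob {x \<in> space M. cmod (I x) > 2 * R * sqrt T}
    \<le> \<sigma>\<^sup>2 / R\<^sup>2 + prob {x \<in> space M. dist (?J k x) (I x) > R * sqrt T}" by blast
qed

end

lemma norm_vector_Re_Im: "norm (vector [Re z, Im z] :: real ^ 2) = cmod z"
  by (simp add: norm_vec_def L2_set_def UNIV_2 cmod_def)

text \<open>Linear functionals of the plane become real parts of complex multiples, so all directions are
covered by one complex parameter \<open>d\<close>.\<close>

lemma inner_vector_Re_Im:
  "inner u (vector [Re z, Im z] :: real ^ 2) = Re (cnj (Complex (u $ 1) (u $ 2)) * z)"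
  by (simp add: inner_vec_def UNIV_2)

lemma cmod_Complex_components: "cmod (Complex (u $ 1) (u $ 2)) = norm (u :: real ^ 2)"
  by (simp add: norm_vec_def L2_set_def UNIV_2 cmod_def)

context square_integrable_levy_process begin

text \<open>The inputs of the continuity theorem are \<open>levy_integral_char_tendsto\<close>, with \<open>d\<close> the product of \<open>c\<close>
and the conjugate of the direction \<open>u\<close>, and \<open>levy_integral_tail\<close> for tightness.\<close>

lemma oscillatory_integral_CLT:
  assumes \<omega>: "\<omega> > 0"
  shows "tendsto_in_distribution M
    (\<lambda>T x. let z = complex_of_real (1 / sqrt T) * c * levy_integral M L (osc \<omega>) T x
      in vector [Re z, Im z] :: real ^ 2)
    (mv_normal 0 ((\<sigma>\<^sup>2 / 2 * (cmod c)\<^sup>2) *\<^sub>R Finite_Cartesian_Product.mat 1)) at_top"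
proof -
  define I where "I = levy_integral M L (osc \<omega>)"
  define Z where "Z T x = complex_of_real (1 / sqrt T) * c * I T x" for T x
  have I: "is_levy_integral M L (osc \<omega>) T (I T)" if "T > 0" for T
  proof -
    have "\<exists>J. is_levy_integral M L (osc \<omega>) T J"
    proof (rule ex_is_levy_integral)
      show "subdivision T (Suc k) (grid T (Suc k))" for k using that by (intro subdivision_grid) auto
      show "uniform_limit {0<..T} (\<lambda>k. osc_step \<omega> T (Suc k)) (osc \<omega>) sequentially"
        using that by (intro osc_step_uniform_limit) simp
    qed (use that in simp)
    then show ?thesis unfolding I_def levy_integral_def by (rule someI_ex)
  qed
  let ?V = "\<lambda>T x. vector [Re (Z T x), Im (Z T x)] :: real ^ 2"
  have s: "0 \<le> \<sigma>\<^sup>2 / 2 * (cmod c)\<^sup>2" by simp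
  have "tendsto_in_distribution M ?V
    (mv_normal 0 ((\<sigma>\<^sup>2 / 2 * (cmod c)\<^sup>2) *\<^sub>R Finite_Cartesian_Product.mat 1)) at_top"
  proof (rule tendsto_in_distribution_of_char)
    show "prob_space M" by (rule prob_space_axioms)
    show "prob_space (mv_normal 0 ((\<sigma>\<^sup>2 / 2 * (cmod c)\<^sup>2) *\<^sub>R Finite_Cartesian_Product.mat 1 :: real ^ 2 ^ 2))"
      by (rule prob_space_mv_normal)
    show "sets (mv_normal 0 ((\<sigma>\<^sup>2 / 2 * (cmod c)\<^sup>2) *\<^sub>R Finite_Cartesian_Product.mat 1 :: real ^ 2 ^ 2)) = sets borel"
      by (simp add: mv_normal_def)
    show "\<forall>\<^sub>F T in at_top. ?V T \<in> borel_measurable M"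
      using eventually_gt_at_top[of 0]
    proof eventually_elim
      case (elim T)
      then have [measurable]: "I T \<in> borel_measurable M" using I by (simp add: is_levy_integral_def)
      have "continuous_on UNIV (\<lambda>z. vector [Re z, Im z] :: real ^ 2)"
      proof -
        have "(\<lambda>z. vector [Re z, Im z] :: real ^ 2) = (\<lambda>z. \<chi> i. if i = 1 then Re z else Im z)"
          by (auto simp: fun_eq_iff Finite_Cartesian_Product.vec_eq_iff forall_2)
        moreover have "continuous_on UNIV (\<lambda>z. \<chi> i::2. if i = 1 then Re z else Im z)"
        proof (rule continuous_on_vec_lambda)
          show "continuous_on UNIV (\<lambda>z. if i = 1 then Re z else Im z)" for i :: 2
            by (cases "i = 1") (auto intro!: continuous_intros)
        qed
        ultimately show ?thesis by (rule ssubst[where P = "continuous_on UNIV"])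
      qed
      moreover have "Z T \<in> borel_measurable M" unfolding Z_def by measurable
      ultimately show ?case by (rule borel_measurable_continuous_on)
    qed
    show "((\<lambda>T. \<integral>x. cis (inner u (?V T x)) \<partial>M) \<longlongrightarrow>
        (\<integral>y. cis (inner u y) \<partial>mv_normal 0 ((\<sigma>\<^sup>2 / 2 * (cmod c)\<^sup>2) *\<^sub>R Finite_Cartesian_Product.mat 1))) at_top" for u
    proof -
      define d where "d = cnj (Complex (u $ 1) (u $ 2)) * c"
      have inner_eq: "inner u (?V T x) = Re (d * I T x) / sqrt T" for T x
      proof -
        have "cnj (Complex (u $ 1) (u $ 2)) * Z T x = complex_of_real (1 / sqrt T) * (d * I T x)"
          by (simp only: Z_def d_def mult_ac)
        then have "inner u (?V T x) = Re (complex_of_real (1 / sqrt T) * (d * I T x))"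
          by (simp only: inner_vector_Re_Im)
        also have "\<dots> = 1 / sqrt T * Re (d * I T x)"
          unfolding times_complex.sel[of "complex_of_real (1 / sqrt T)"] by simp
        finally show ?thesis by simp
      qed
      have variance_eq: "\<sigma>\<^sup>2 * (cmod d)\<^sup>2 / 4 = \<sigma>\<^sup>2 / 2 * (cmod c)\<^sup>2 * (norm u)\<^sup>2 / 2"
        by (simp add: d_def norm_mult cmod_Complex_components power_mult_distrib)
      show ?thesis
        unfolding inner_eq char_mv_normal_scaled_mat_1[OF s] variance_eq[symmetric]
        by (rule levy_integral_char_tendsto[OF \<omega> I])
    qed
    fix \<epsilon> :: real assume "\<epsilon> > 0"
    \<comment> \<open>Chosen such that \<open>\<sigma>\<^sup>2 / R\<^sup>2 < \<epsilon>\<close>, also for \<open>\<sigma> = 0\<close>.\<close>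
    define R where "R = sqrt (\<sigma>\<^sup>2 / \<epsilon> + 1)"
    have R2: "R\<^sup>2 = \<sigma>\<^sup>2 / \<epsilon> + 1" unfolding R_def using \<open>\<epsilon> > 0\<close> by (intro real_sqrt_pow2) simp
    have "0 < R" unfolding R_def using \<open>\<epsilon> > 0\<close> by (simp add: add_nonneg_pos)
    have "\<sigma>\<^sup>2 < \<epsilon> * R\<^sup>2" using \<open>\<epsilon> > 0\<close> by (simp add: R2 distrib_left)
    then have small: "\<sigma>\<^sup>2 / R\<^sup>2 < \<epsilon>" using \<open>0 < R\<close> by (simp add: divide_less_eq)
    show "\<exists>K. \<forall>\<^sub>F T in at_top. prob {x \<in> space M. norm (?V T x) > K} < \<epsilon>"
    \<comment> \<open>The summand 1 keeps the inequality strict for \<open>c = 0\<close>.\<close>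
    proof (rule exI[of _ "(cmod c + 1) * (2 * R)"], use eventually_gt_at_top[of 0] in eventually_elim)
      case (elim T)
      have [measurable]: "I T \<in> borel_measurable M" using I[OF elim] by (simp add: is_levy_integral_def)
      have "cmod (I T x) > 2 * R * sqrt T" if "norm (?V T x) > (cmod c + 1) * (2 * R)" for x
      proof (rule ccontr)
        assume "\<not> cmod (I T x) > 2 * R * sqrt T"
        then have "cmod (I T x) / sqrt T \<le> 2 * R" using elim by (simp add: divide_le_eq)
        then have "cmod c * (cmod (I T x) / sqrt T) \<le> cmod c * (2 * R)" by (intro mult_left_mono) auto
        moreover have "norm (?V T x) = cmod c * (cmod (I T x) / sqrt T)"
          unfolding norm_vector_Re_Im Z_def using elim by (simp add: norm_mult norm_divide)
        ultimately show False using that \<open>0 < R\<close> by (simp add: distrib_right)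
      qed
      then have "prob {x \<in> space M. norm (?V T x) > (cmod c + 1) * (2 * R)} \<le> prob {x \<in> space M. cmod (I T x) > 2 * R * sqrt T}"
        by (intro finite_measure_mono) auto
      also have "\<dots> \<le> \<sigma>\<^sup>2 / R\<^sup>2" using I[OF elim] elim \<open>0 < R\<close> by (rule levy_integral_tail)
      finally show ?case using small by simp
    qed
  qed
  then show ?thesis by (simp add: Let_def Z_def I_def)
qed

end

theorem theorem3p6:
  fixes M :: "'a measure" and F :: "real \<Rightarrow> 'a measure" and L :: "real \<Rightarrow> 'a \<Rightarrow> real"
    and p q :: nat and a b :: "nat \<Rightarrow> real" and \<sigma> \<omega> :: real
  assumes "q < p" and "b q \<noteq> 0" and "\<And>j. q < j \<Longrightarrow> j < p \<Longrightarrow> b j = 0"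
    and "levy_process M F L"
    and "integrable M (L 1)" and "(\<integral>x. L 1 x \<partial>M) = 0"
    and "integrable M (\<lambda>x. \<bar>L 1 x\<bar>\<^sup>2)" and "(\<integral>x. \<bar>L 1 x\<bar>\<^sup>2 \<partial>M) = \<sigma>\<^sup>2"
    and "\<And>z. eigenvalue (map_mat complex_of_real (companion p a)) z \<Longrightarrow> Re z < 0"
    and "\<omega> > 0"
  shows "tendsto_in_distribution M
    (\<lambda>T x. vector [Re (scaled_transform M L p a b \<omega> T x),
                  Im (scaled_transform M L p a b \<omega> T x)] :: real ^ 2)
    (mv_normal 0
      ((\<sigma>\<^sup>2 / 2 * (cmod (ma_poly p b (\<i> * \<omega>) / ar_poly p a (\<i> * \<omega>)))\<^sup>2)
        *\<^sub>R Finite_Cartesian_Product.mat 1))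
    at_top"
proof -
  interpret levy_process M F L by fact
  interpret square_integrable_levy_process M F L \<sigma>
    by unfold_locales (use assms in simp_all)
  have "(\<lambda>t. exp (- (\<i> * complex_of_real \<omega> * complex_of_real t))) = osc \<omega>"
    by (simp add: fun_eq_iff osc_def cis_conv_exp mult.assoc)
  then show ?thesis
    using oscillatory_integral_CLT[OF \<open>\<omega> > 0\<close>, of "ma_poly p b (\<i> * \<omega>) / ar_poly p a (\<i> * \<omega>)"]
    by (simp only: scaled_transform_def Let_def)
qed

end
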